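(* Let $N$ be the space dimension, let $p\geq 1$, and let $d_1,\dots,d_p$ be constants with $0<\delta_\star\le d_i\le\delta^\star$. There exists a constant $K>0$ such that, for every $M\ge 0$ which is a solution of $$\partial_t M-\Delta(dM)=0\quad\text{in } Q_2,\qquad M=\sum_{i=1}^p a_i,\qquad d=\frac{\sum_{i=1}^p d_i a_i}{\sum_{i=1}^p a_i},$$ where $a_1,\dots,a_p$ are non negative functions on $Q_2$, one has $$\|M\|_{L^{(N+1)/N}(Q_1)}\le K\ \sup_{-4\le t\le 0}\int_{B_2}M(t,x)\,\mathrm{d}x.$$
   Context: For $\rho>0$, $B_\rho=\{x\in\mathbb{R}^N:\ |x|\le\rho\}$ and $Q_\rho=(-\rho^2,0)\times B_\rho$. The Laplacian acts on $x\in\mathbb{R}^N$. The coefficient $d$ satisfies $\delta_\star\le d(t,x)\le\delta^\star$, and $dM=\sum_{i=1}^p d_i a_i$ (in particular $dM=0$ where $M=0$). The estimate is an a priori estimate: the functions $a_i$ (hence $M$) are smooth, up to the boundary of $Q_2$. *)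

theory Defs
  imports "HOL-Analysis.Analysis"
begin

definition Q_cyl :: "real \<Rightarrow> (real \<times> 'a::euclidean_space) set" where
  "Q_cyl \<rho> = {- (\<rho>\<^sup>2)<..<0} \<times> cball 0 \<rho>"

text \<open>Iterated directional derivative: the head of the list is differentiated last.\<close>

primrec iter_deriv :: "'a::real_normed_vector list \<Rightarrow> ('a \<Rightarrow> real) \<Rightarrow> 'a \<Rightarrow> real" where
  "iter_deriv [] f = f"
| "iter_deriv (v # vs) f = (\<lambda>z. frechet_derivative (iter_deriv vs f) (at z) v)"

text \<open>
  Smoothness up to the boundary of \<open>S\<close>: in the interior all partial derivatives of all orders
  exist, and each of them extends continuously to the closure. The function itself is its own
  extension, so its values on the boundary are the limits of the interior ones.
\<close>

definition smooth_up_to_boundary :: "'a::euclidean_space set \<Rightarrow> ('a \<Rightarrow> real) \<Rightarrow> bool" where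
  "smooth_up_to_boundary S f \<longleftrightarrow>
     continuous_on (closure S) f \<and>
     (\<forall>vs. set vs \<subseteq> Basis \<longrightarrow>
        (\<forall>z\<in>interior S. iter_deriv vs f differentiable (at z)) \<and>
        (\<exists>g. continuous_on (closure S) g \<and> (\<forall>z\<in>interior S. g z = iter_deriv vs f z)))"

definition laplacian :: "('a::euclidean_space \<Rightarrow> real) \<Rightarrow> 'a \<Rightarrow> real" where
  "laplacian f x = (\<Sum>b\<in>Basis. iter_deriv [b, b] f x)"

text \<open>
  The Bochner integral is \<open>0\<close> for non-integrable integrands, so this is the \<open>L\<^sup>q\<close> norm only for
  \<open>f\<close> in \<open>L\<^sup>q\<close>; this includes every \<open>f\<close> that is continuous on the closure of a bounded Borel set
  \<open>S\<close> (with \<open>q > 0\<close>).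
\<close>

definition Lq_norm :: "real \<Rightarrow> 'a::euclidean_space set \<Rightarrow> ('a \<Rightarrow> real) \<Rightarrow> real" where
  "Lq_norm q S f = (LINT z:S|lborel. \<bar>f z\<bar> powr q) powr (1 / q)"

text \<open>
  \<open>M\<close> (pairs are \<open>(t, x)\<close>) is a nonnegative solution on \<open>Q\<close> of the equation with coefficient \<open>d\<close>,
  where \<open>M\<close> is the sum of the smooth nonnegative functions \<open>a i\<close> and \<open>d\<close> is the average of the
  constants \<open>c i\<close> with weights \<open>a i\<close>. Where \<open>M = 0\<close> the quotient is not defined and \<open>d\<close> is only
  required to lie between the bounds, so that \<open>d M = 0 = (\<Sum>i. c i * a i)\<close> there.
  The equation is imposed in the interior of \<open>Q\<close>, where ordinary derivatives make sense; for
  functions smooth up to the boundary it then holds on \<open>Q\<close> by continuity. The sum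
  representation of \<open>M\<close> is required on the closure, which fixes the boundary values of \<open>M\<close>.
\<close>

definition nonneg_solution ::
  "(real \<times> 'a::euclidean_space) set \<Rightarrow> real \<Rightarrow> real \<Rightarrow> nat \<Rightarrow> (nat \<Rightarrow> real) \<Rightarrow>
   (nat \<Rightarrow> real \<times> 'a \<Rightarrow> real) \<Rightarrow> (real \<times> 'a \<Rightarrow> real) \<Rightarrow> (real \<times> 'a \<Rightarrow> real) \<Rightarrow> bool" where
  "nonneg_solution Q \<delta>lo \<delta>hi p c a d M \<longleftrightarrow>
     (\<forall>i\<in>{1..p}. smooth_up_to_boundary Q (a i) \<and> (\<forall>z\<in>Q. 0 \<le> a i z)) \<and>
     (\<forall>z\<in>closure Q. M z = (\<Sum>i=1..p. a i z)) \<and>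
     (\<forall>z\<in>Q. 0 \<le> M z) \<and>
     (\<forall>z\<in>Q. \<delta>lo \<le> d z \<and> d z \<le> \<delta>hi) \<and>
     (\<forall>z\<in>Q. M z \<noteq> 0 \<longrightarrow> d z = (\<Sum>i=1..p. c i * a i z) / (\<Sum>i=1..p. a i z)) \<and>
     (\<forall>(t, x)\<in>interior Q.
        deriv (\<lambda>s. M (s, x)) t - laplacian (\<lambda>y. d (t, y) * M (t, y)) x = 0)"

end

theory Submission
  imports Defs
begin

text \<open>
  Put \<open>u = d M = (\<Sum>i. c i * a i)\<close>. Then \<open>M\<^sub>t = \<Delta> u\<close>, and \<open>u\<close> is comparable with \<open>M\<close>:
  \<open>\<delta>lo M \<le> u \<le> \<delta>hi M\<close>. The estimates start from these two facts and bound \<open>M\<close> in \<open>L\<^sup>2(Q\<^sub>1)\<close>;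
  since \<open>1 < (N + 1) / N \<le> 2\<close> this is enough.

  The device is an interaction energy \<open>E = \<integral>\<integral> M(x) M(y) k(\<bar>x - y\<bar>) dx dy\<close>. As the Laplacian acts on
  the kernel in both variables, \<open>dE/dt = \<integral>\<integral> (u(x) M(y) + M(x) u(y)) \<Delta>k\<close>, so a kernel that is bounded
  above and subharmonic turns a lower bound of the initial energy into a space-time bound of
  \<open>\<integral>\<integral> M(x) M(y) \<Delta>k\<close>. Choose \<open>k' = r\<^sup>-\<^sup>j\<close> with \<open>k(5) = 0\<close>, where \<open>r\<close> never exceeds \<open>5\<close>. Then
  \<open>- 5 r\<^sup>-\<^sup>j \<le> k \<le> 0\<close>, and \<open>\<Delta>k\<close> is of size \<open>r\<close> to the power \<open>- j - 1\<close> as long as \<open>j + 1 < N\<close>. Hence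
  a bound of the energy with kernel \<open>r\<^sup>-\<^sup>j\<close> gives one for the energy with the kernel that is more
  singular by one order: the terms produced by the cutoff in space contain \<open>k\<close> and \<open>\<nabla>k\<close>, both of size at
  most \<open>r\<^sup>-\<^sup>j\<close>, and one more factor \<open>t + 4\<close> in each step makes the initial energy vanish, at the price of
  the time integral of the previous one. The induction starts at \<open>j = 0\<close>, where the energy is at most a multiple of the squared
  mass, and its last step \<open>j = N - 1\<close> uses the fundamental solution, for which \<open>\<Delta>k\<close> is a multiple of
  the Dirac mass: what is then bounded is \<open>\<integral>\<integral> M\<^sup>2\<close>.

  To keep all integrands continuous, \<open>\<bar>x - y\<bar>\<close> is replaced by \<open>r = sqrt (\<bar>x - y\<bar>\<^sup>2 + \<epsilon>\<^sup>2)\<close> with bounds that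
  are uniform in \<open>\<epsilon>\<close>; for \<open>j = N - 1\<close> the kernel \<open>\<Delta>k = N \<epsilon>\<^sup>2 / r\<^sup>N\<^sup>+\<^sup>2\<close> is an approximate identity. The energy
  step is \<open>dissipation_le_energy\<close>, the induction is \<open>energy_le\<close>, the limit \<open>\<epsilon> \<rightarrow> 0\<close> is taken in
  \<open>L2_bound\<close>, and \<open>nonneg_solution_weighted_diffusion\<close> connects these to the system.
\<close>

section \<open>Fubini and integration by parts on compact sets\<close>

lemma set_integrable_compact:
  fixes f :: "'a::euclidean_space \<Rightarrow> real"
  assumes "compact S" "continuous_on S f"
  shows "set_integrable lborel S f"
  using borel_integrable_compact[OF assms] by (simp add: set_integrable_def)

lemma
  fixes f :: "'a::euclidean_space \<times> 'b::euclidean_space \<Rightarrow> real"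
  assumes A: "compact A" and B: "compact B" and f: "continuous_on (A \<times> B) f"
  shows set_integral_Times_fst:
      "(LINT z:A \<times> B|lborel. f z) = (LINT x:A|lborel. LINT y:B|lborel. f (x, y))"
    and set_integral_Times_snd:
      "(LINT z:A \<times> B|lborel. f z) = (LINT y:B|lborel. LINT x:A|lborel. f (x, y))"
    and set_integrable_Times_fst:
      "set_integrable lborel A (\<lambda>x. LINT y:B|lborel. f (x, y))"
proof -
  let ?g = "\<lambda>z. indicator (A \<times> B) z *\<^sub>R f z"
  have int: "integrable (lborel \<Otimes>\<^sub>M lborel) ?g"
    using borel_integrable_compact[OF compact_Times[OF A B] f] by (simp add: lborel_prod)
  then have int': "integrable (lborel \<Otimes>\<^sub>M lborel) (\<lambda>(x, y). ?g (x, y))"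
    by (simp add: case_prod_beta')
  have split: "?g (x, y) = indicator A x * (indicator B y * f (x, y))" for x y
    by (simp add: indicator_times)
  show fst: "(LINT z:A \<times> B|lborel. f z) = (LINT x:A|lborel. LINT y:B|lborel. f (x, y))"
    unfolding set_lebesgue_integral_def lborel_prod[symmetric]
      lborel_pair.integral_fst'[OF int, symmetric] split by simp
  have split': "?g (x, y) = indicator B y * (indicator A x * f (x, y))" for x y
    by (simp add: indicator_times)
  have "(LINT y|lborel. LINT x|lborel. indicator B y * (indicator A x * f (x, y))) =
      (LINT x|lborel. LINT y|lborel. indicator A x * (indicator B y * f (x, y)))"
    unfolding split[symmetric] split'[symmetric] by (rule lborel_pair.Fubini_integral[OF int'])
  then show "(LINT z:A \<times> B|lborel. f z) = (LINT y:B|lborel. LINT x:A|lborel. f (x, y))"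
    unfolding fst unfolding set_lebesgue_integral_def by simp
  show "set_integrable lborel A (\<lambda>x. LINT y:B|lborel. f (x, y))"
    using lborel_pair.integrable_fst'[OF int]
    unfolding set_integrable_def set_lebesgue_integral_def split by simp
qed

lemma set_integral_derivative_interior:
  fixes f g :: "real \<Rightarrow> real"
  assumes "a \<le> b" "continuous_on {a..b} f" and g: "continuous_on {a..b} g"
    and "\<And>t. t \<in> {a<..<b} \<Longrightarrow> (f has_real_derivative g t) (at t)"
  shows "(LINT t:{a..b}|lborel. g t) = f b - f a"
proof -
  have "(g has_integral (f b - f a)) {a..b}"
    using assms by (intro fundamental_theorem_of_calculus_interior)
      (auto simp: has_real_derivative_iff_has_vector_derivative)
  then show ?thesis
    using set_borel_integral_eq_integral(2)[OF set_integrable_compact[OF compact_Icc g]]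
    by (simp add: integral_unique)
qed

lemma set_integral_support:
  fixes F :: "'a::euclidean_space \<Rightarrow> real"
  assumes "\<And>x. x \<notin> S \<Longrightarrow> F x = 0"
  shows "(LINT x:S|lborel. F x) = (LINT x|lborel. F x)"
  unfolding set_lebesgue_integral_def
  by (rule Bochner_Integration.integral_cong) (auto simp: indicator_def assms)

lemma lborel_integral_translate:
  fixes F :: "'a::euclidean_space \<Rightarrow> real"
  assumes "continuous_on UNIV F"
  shows "(LINT x|lborel. F (x + c)) = (LINT x|lborel. F x)"
proof -
  have F: "F \<in> borel_measurable borel"
    using assms by (rule borel_measurable_continuous_onI)
  have "(LINT x|lborel. F x) = (LINT x|distr lborel borel ((+) c). F x)"
    by (simp add: lborel_distr_plus)
  also have "\<dots> = (LINT x|lborel. F (c + x))"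
    by (rule integral_distr) (auto intro: F)
  finally show ?thesis by (simp add: add.commute)
qed

text \<open>
  By translation invariance \<open>\<integral> F(x + b) - F(x) dx = 0\<close>. Writing the difference as
  \<open>\<integral>\<^sub>0\<^sup>1 G(x + s b) ds\<close> and exchanging the integrals gives \<open>\<integral> G\<close>. This avoids integrating
  along coordinate lines.
\<close>

lemma integral_directional_derivative_zero:
  fixes F G :: "'a::euclidean_space \<Rightarrow> real"
  assumes F: "continuous_on UNIV F" and G: "continuous_on UNIV G"
    and supp: "\<And>x. R \<le> norm x \<Longrightarrow> F x = 0 \<and> G x = 0"
    and deriv: "\<And>x. ((\<lambda>s. F (x + s *\<^sub>R b)) has_real_derivative G x) (at 0)"
  shows "(LINT x|lborel. G x) = 0"
proof -
  define C :: "'a set" where "C = cball 0 (R + norm b)"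
  have out: "R \<le> norm (x + s *\<^sub>R b)" if "x \<notin> C" "s \<in> {0..1}" for x s
  proof -
    have "norm x \<le> norm (x + s *\<^sub>R b) + norm (s *\<^sub>R b)"
      by (metis add_diff_cancel norm_triangle_sub norm_minus_commute add.commute norm_triangle_ineq4)
    moreover have "norm (s *\<^sub>R b) \<le> 1 * norm b"
      unfolding norm_scaleR using that by (intro mult_right_mono) auto
    ultimately show ?thesis using that by (auto simp: C_def)
  qed
  have contF: "continuous_on S (\<lambda>x. F (h x))" if "continuous_on S h" for S :: "'z::topological_space set" and h
    by (rule continuous_on_compose2[OF F that]) auto
  have contG: "continuous_on S (\<lambda>x. G (h x))" if "continuous_on S h" for S :: "'z::topological_space set" and h
    by (rule continuous_on_compose2[OF G that]) auto
  have deriv': "((\<lambda>s. F (x + s *\<^sub>R b)) has_real_derivative G (x + s *\<^sub>R b)) (at s)" for x s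
    using deriv[of "x + s *\<^sub>R b"] DERIV_shift[of "\<lambda>s. F (x + s *\<^sub>R b)" "G (x + s *\<^sub>R b)" 0 s]
    by (simp add: algebra_simps)
  have inc: "(LINT s:{0..1}|lborel. G (x + s *\<^sub>R b)) = F (x + b) - F x" for x
    using set_integral_derivative_interior[of 0 1 "\<lambda>s. F (x + s *\<^sub>R b)" "\<lambda>s. G (x + s *\<^sub>R b)"]
    by (simp add: deriv' contF contG continuous_intros)
  have Gint: "(LINT x:C|lborel. G (x + s *\<^sub>R b)) = (LINT x|lborel. G x)" if "s \<in> {0..1}" for s
    using set_integral_support[of C "\<lambda>x. G (x + s *\<^sub>R b)"] lborel_integral_translate[OF G]
      out[OF _ that] supp by metis
  have F0: "(LINT x:C|lborel. F (x + s *\<^sub>R b)) = (LINT x|lborel. F x)" if "s \<in> {0..1}" for s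
    using set_integral_support[of C "\<lambda>x. F (x + s *\<^sub>R b)"] lborel_integral_translate[OF F]
      out[OF _ that] supp by metis
  have cC: "compact C" by (simp add: C_def)
  have "(LINT x|lborel. G x) = (LINT s:{0..1::real}|lborel. (LINT x|lborel. G x))"
    by (simp add: set_lebesgue_integral_def content_real)
  also have "\<dots> = (LINT s:{0..1}|lborel. LINT x:C|lborel. G (x + s *\<^sub>R b))"
    by (rule set_lebesgue_integral_cong) (auto simp: Gint)
  also have "\<dots> = (LINT x:C|lborel. LINT s:{0..1}|lborel. G (x + s *\<^sub>R b))"
    using set_integral_Times_fst[OF compact_Icc cC, of 0 1 "\<lambda>(s, x). G (x + s *\<^sub>R b)"]
      set_integral_Times_snd[OF compact_Icc cC, of 0 1 "\<lambda>(s, x). G (x + s *\<^sub>R b)"]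
    by (simp add: contG case_prod_unfold continuous_intros)
  also have "\<dots> = (LINT x:C|lborel. F (x + b) - F x)"
    by (simp add: inc)
  also have "\<dots> = (LINT x:C|lborel. F (x + b)) - (LINT x:C|lborel. F x)"
    using cC by (intro set_integral_diff set_integrable_compact contF continuous_intros)
  also have "\<dots> = 0"
    using F0[of 0] F0[of 1] by simp
  finally show ?thesis .
qed

lemma continuous_on_cutoff_mult:
  fixes \<phi> f :: "'a::euclidean_space \<Rightarrow> real"
  assumes \<phi>: "continuous_on UNIV \<phi>" and supp: "\<And>x. R \<le> norm x \<Longrightarrow> \<phi> x = 0"
    and f: "continuous_on (ball 0 \<rho>) f" and "R < \<rho>"
  shows "continuous_on UNIV (\<lambda>x. \<phi> x * f x)"
proof -
  have "continuous_on (ball 0 \<rho> \<union> - cball 0 R) (\<lambda>x. \<phi> x * f x)"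
  proof (rule continuous_on_open_Un)
    show "continuous_on (ball 0 \<rho>) (\<lambda>x. \<phi> x * f x)"
      by (intro continuous_intros f continuous_on_subset[OF \<phi>]) auto
    have "continuous_on (- cball 0 R) (\<lambda>x. 0::real)" by simp
    then show "continuous_on (- cball 0 R) (\<lambda>x. \<phi> x * f x)"
      by (rule continuous_on_eq) (auto simp: supp)
  qed auto
  moreover have "ball 0 \<rho> \<union> - cball 0 R = (UNIV :: 'a set)" using \<open>R < \<rho>\<close> by auto
  ultimately show ?thesis by simp
qed

text \<open>
  Each \<open>\<phi> f2 - \<phi>2 f\<close> is the derivative of \<open>\<phi> f1 - \<phi>1 f\<close> in its direction. Only the test function is
  given on the whole space: \<open>f\<close> and its derivatives need to make sense on the open ball alone, since
  \<open>\<phi>\<close> vanishes near and outside the sphere.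
\<close>

lemma green_identity:
  fixes \<phi> f :: "'a::euclidean_space \<Rightarrow> real" and \<phi>1 \<phi>2 f1 f2 :: "'a \<Rightarrow> 'a \<Rightarrow> real"
  assumes R: "R < \<rho>"
    and \<phi>: "continuous_on UNIV \<phi>" "\<And>b. b \<in> Basis \<Longrightarrow> continuous_on UNIV (\<phi>1 b)"
      "\<And>b. b \<in> Basis \<Longrightarrow> continuous_on UNIV (\<phi>2 b)"
    and supp: "\<And>x. R \<le> norm x \<Longrightarrow> \<phi> x = 0"
      "\<And>b x. b \<in> Basis \<Longrightarrow> R \<le> norm x \<Longrightarrow> \<phi>1 b x = 0"
      "\<And>b x. b \<in> Basis \<Longrightarrow> R \<le> norm x \<Longrightarrow> \<phi>2 b x = 0"
    and d\<phi>: "\<And>b x. b \<in> Basis \<Longrightarrow> ((\<lambda>s. \<phi> (x + s *\<^sub>R b)) has_real_derivative \<phi>1 b x) (at 0)"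
      "\<And>b x. b \<in> Basis \<Longrightarrow> ((\<lambda>s. \<phi>1 b (x + s *\<^sub>R b)) has_real_derivative \<phi>2 b x) (at 0)"
    and f: "continuous_on (ball 0 \<rho>) f" "\<And>b. b \<in> Basis \<Longrightarrow> continuous_on (ball 0 \<rho>) (f1 b)"
      "\<And>b. b \<in> Basis \<Longrightarrow> continuous_on (ball 0 \<rho>) (f2 b)"
    and df: "\<And>b x. b \<in> Basis \<Longrightarrow> x \<in> ball 0 \<rho> \<Longrightarrow> ((\<lambda>s. f (x + s *\<^sub>R b)) has_real_derivative f1 b x) (at 0)"
      "\<And>b x. b \<in> Basis \<Longrightarrow> x \<in> ball 0 \<rho> \<Longrightarrow> ((\<lambda>s. f1 b (x + s *\<^sub>R b)) has_real_derivative f2 b x) (at 0)"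
  shows "(LINT x:cball 0 \<rho>|lborel. \<phi> x * (\<Sum>b\<in>Basis. f2 b x)) =
         (LINT x:cball 0 \<rho>|lborel. f x * (\<Sum>b\<in>Basis. \<phi>2 b x))"
proof -
  note cut = continuous_on_cutoff_mult[OF _ _ _ R]
  define G where "G b x = \<phi> x * f2 b x - \<phi>2 b x * f x" for b x
  have contG: "continuous_on UNIV (G b)" if "b \<in> Basis" for b
    unfolding G_def using that by (intro continuous_on_diff cut \<phi> supp f)
  have G0: "(LINT x|lborel. G b x) = 0" if b: "b \<in> Basis" for b
  proof (rule integral_directional_derivative_zero)
    show "continuous_on UNIV (\<lambda>x. \<phi> x * f1 b x - \<phi>1 b x * f x)"
      using b by (intro continuous_on_diff cut \<phi> supp f)
    show "continuous_on UNIV (G b)" using b by (rule contG)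
    show "\<phi> x * f1 b x - \<phi>1 b x * f x = 0 \<and> G b x = 0" if "R \<le> norm x" for x
      using that b by (simp add: G_def supp)
    show "((\<lambda>s. \<phi> (x + s *\<^sub>R b) * f1 b (x + s *\<^sub>R b) - \<phi>1 b (x + s *\<^sub>R b) * f (x + s *\<^sub>R b))
            has_real_derivative G b x) (at 0)" for x
    proof (cases "x \<in> ball 0 \<rho>")
      case True
      show ?thesis
        by (rule derivative_eq_intros d\<phi>[OF b] df[OF b True] refl)+ (simp add: G_def algebra_simps)
    next
      case False
      \<comment> \<open>Away from the open ball the product vanishes near \<open>x\<close>, whatever the values of \<open>f\<close> are there.\<close>
    have "\<forall>\<^sub>F s in nhds 0. x + s *\<^sub>R b \<in> - cball 0 R"
        using False R by (intro topological_tendstoD[where f = "\<lambda>s. x + s *\<^sub>R b" and l = x])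
          (auto intro!: tendsto_eq_intros filterlim_ident)
      then have ev: "\<forall>\<^sub>F s in nhds 0. \<phi> (x + s *\<^sub>R b) * f1 b (x + s *\<^sub>R b)
          - \<phi>1 b (x + s *\<^sub>R b) * f (x + s *\<^sub>R b) = 0"
        by eventually_elim (use b in \<open>simp add: supp\<close>)
      have "G b x = 0" using False R b by (simp add: G_def supp)
      then show ?thesis using DERIV_cong_ev[OF refl ev refl] by simp
    qed
  qed
  have out: "x \<notin> cball 0 \<rho> \<Longrightarrow> R \<le> norm x" for x :: 'a using R by simp
  have i1: "set_integrable lborel (cball 0 \<rho>) (\<lambda>x. \<phi> x * f2 b x)"
    and i2: "set_integrable lborel (cball 0 \<rho>) (\<lambda>x. \<phi>2 b x * f x)" if "b \<in> Basis" for b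
    using that by (auto intro!: set_integrable_compact continuous_on_subset[OF cut] \<phi> supp f)
  have "(LINT x:cball 0 \<rho>|lborel. \<phi> x * f2 b x) = (LINT x:cball 0 \<rho>|lborel. \<phi>2 b x * f x)"
    if b: "b \<in> Basis" for b
  proof -
    have "(LINT x:cball 0 \<rho>|lborel. G b x) = 0"
      using G0[OF b] set_integral_support[of "cball 0 \<rho>" "G b"] out b by (simp add: G_def supp)
    then show ?thesis
      unfolding G_def using set_integral_diff(2)[OF i1[OF b] i2[OF b]] by simp
  qed
  then have "(\<Sum>b\<in>Basis. LINT x:cball 0 \<rho>|lborel. \<phi> x * f2 b x) =
      (\<Sum>b\<in>Basis. LINT x:cball 0 \<rho>|lborel. f x * \<phi>2 b x)"
    by (simp add: mult.commute)
  then show ?thesis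
    unfolding sum_distrib_left set_lebesgue_integral_def scaleR_sum_right
    using i1 i2 unfolding set_integrable_def
    by (subst (1 2) Bochner_Integration.integral_sum) (auto simp: mult.commute)
qed

section \<open>Regularised radial kernels and the spatial cutoff\<close>

text \<open>
  The antiderivative of \<open>r\<^sup>-\<^sup>j\<close> that vanishes at \<open>5\<close>. The value \<open>5\<close> is a bound for the regularised
  distance of two points of the ball of radius \<open>2\<close>, so this kernel is never positive there.
\<close>

definition radial_kernel :: "nat \<Rightarrow> real \<Rightarrow> real" where
  "radial_kernel j r =
     (if j = 1 then ln r - ln 5 else (r powr (1 - real j) - 5 powr (1 - real j)) / (1 - real j))"

lemma radial_kernel_deriv:
  assumes "0 < r"
  shows "(radial_kernel j has_real_derivative 1 / r ^ j) (at r)"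
proof (cases "j = 1")
  case True
  then show ?thesis
    using assms unfolding radial_kernel_def[abs_def]
    by (auto intro!: derivative_eq_intros simp: divide_simps)
next
  case False
  then have [simp]: "1 - real j \<noteq> 0" by auto
  have *: "r powr (- real j) = 1 / r ^ j"
    using assms by (simp add: powr_minus powr_realpow divide_simps)
  have "((\<lambda>r. (r powr (1 - real j) - 5 powr (1 - real j)) / (1 - real j))
      has_real_derivative (1 - real j) * r powr (1 - real j - 1) / (1 - real j)) (at r)"
    using assms by (auto intro!: derivative_eq_intros)
  then show ?thesis
    using False by (simp add: radial_kernel_def[abs_def] *)
qed

text \<open>
  By the mean value theorem the kernel is not more singular than its derivative, so both are controlled
  by the density of the energy of order \<open>j\<close>.
\<close>

lemma radial_kernel_bounds:
  assumes "0 < r" "r \<le> 5"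
  shows "radial_kernel j r \<le> 0" and "- radial_kernel j r \<le> 5 / r ^ j"
proof -
  have 5: "radial_kernel j 5 = 0" by (simp add: radial_kernel_def)
  have "radial_kernel j r \<le> 0 \<and> - radial_kernel j r \<le> 5 / r ^ j"
  proof (cases "r = 5")
    case True
    then show ?thesis using 5 by simp
  next
    case False
    then have "r < 5" using assms by simp
    from MVT2[OF this, of "radial_kernel j" "\<lambda>w. 1 / w ^ j"] radial_kernel_deriv assms
    obtain z where z: "r < z" "z < 5" "radial_kernel j 5 - radial_kernel j r = (5 - r) * (1 / z ^ j)"
      by auto
    have "1 / z ^ j \<le> 1 / r ^ j"
      using assms z by (intro divide_left_mono power_mono mult_pos_pos zero_less_power) auto
    then have "(5 - r) * (1 / z ^ j) \<le> 5 * (1 / r ^ j)"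
      using assms z by (intro mult_mono) auto
    moreover have "0 \<le> (5 - r) * (1 / z ^ j)" using z assms by simp
    ultimately show ?thesis using z 5 by simp
  qed
  then show "radial_kernel j r \<le> 0" and "- radial_kernel j r \<le> 5 / r ^ j" by auto
qed

text \<open>
  Powers of this function are the cutoffs. Each derivative lowers the exponent by one, so the
  energies below carry the exponents \<open>2 j + 1\<close>: the two derivatives in the step from \<open>j\<close> to
  \<open>j + 1\<close> cost exactly the difference of two. The support has radius \<open>3/2\<close>, strictly
  between the radii \<open>1\<close> and \<open>2\<close> of the two cylinders.
\<close>

definition bump :: "'a::euclidean_space \<Rightarrow> real" where
  "bump x = max 0 (9/4 - x \<bullet> x)"

definition reg_dist :: "real \<Rightarrow> 'a::euclidean_space \<Rightarrow> 'a \<Rightarrow> real" where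
  "reg_dist \<epsilon> x y = sqrt ((x - y) \<bullet> (x - y) + \<epsilon>\<^sup>2)"

lemma bump_nonneg [simp]: "0 \<le> bump x" and bump_le: "bump x \<le> 9/4"
  using inner_ge_zero[of x] by (auto simp: bump_def max_def)

lemma bump_eq_0: "3/2 \<le> norm x \<Longrightarrow> bump x = 0"
  using power_mono[of "3/2" "norm x" 2] by (simp add: bump_def power2_norm_eq_inner[symmetric] power2_eq_square)

lemma norm_le_if_bump: "bump x \<noteq> 0 \<Longrightarrow> norm x \<le> 3/2"
  using bump_eq_0[of x] by linarith

lemma continuous_on_bump [continuous_intros]:
  "continuous_on S h \<Longrightarrow> continuous_on S (\<lambda>z. bump (h z))"
  unfolding bump_def by (intro continuous_intros)

lemma reg_dist_pos: "\<epsilon> \<noteq> 0 \<Longrightarrow> 0 < reg_dist \<epsilon> x y"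
  by (simp add: reg_dist_def add_nonneg_pos)

lemma reg_dist_sq: "(reg_dist \<epsilon> x y)\<^sup>2 = (x - y) \<bullet> (x - y) + \<epsilon>\<^sup>2"
  by (simp add: reg_dist_def)

lemma norm_le_reg_dist: "norm (x - y) \<le> reg_dist \<epsilon> x y"
  by (simp add: reg_dist_def norm_eq_sqrt_inner)

lemma reg_dist_commute: "reg_dist \<epsilon> x y = reg_dist \<epsilon> y x"
  by (simp add: reg_dist_def inner_commute inner_diff algebra_simps)

lemma reg_dist_le:
  assumes "norm x \<le> 2" "norm y \<le> 2" "\<bar>\<epsilon>\<bar> \<le> 1"
  shows "reg_dist \<epsilon> x y \<le> 5"
proof -
  have "norm (x - y) \<le> 4" using norm_triangle_ineq4[of x y] assms by linarith
  then have "(norm (x - y))\<^sup>2 \<le> 4\<^sup>2" by (intro power_mono) auto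
  moreover have "\<epsilon>\<^sup>2 \<le> 1" using assms(3) by (simp add: abs_square_le_1)
  ultimately show ?thesis
    unfolding reg_dist_def power2_norm_eq_inner by (intro real_le_lsqrt) auto
qed

lemma continuous_on_reg_dist [continuous_intros]:
  "continuous_on S f \<Longrightarrow> continuous_on S g \<Longrightarrow> continuous_on S (\<lambda>z. reg_dist \<epsilon> (f z) (g z))"
  unfolding reg_dist_def by (intro continuous_intros)

lemma continuous_on_radial_kernel [continuous_intros]:
  assumes "continuous_on S h" "\<And>z. z \<in> S \<Longrightarrow> 0 < h z"
  shows "continuous_on S (\<lambda>z. radial_kernel j (h z))"
proof (rule continuous_on_compose2[OF _ assms(1)])
  show "continuous_on {0<..} (radial_kernel j)"
    by (meson DERIV_isCont continuous_at_imp_continuous_on greaterThan_iff radial_kernel_deriv)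
qed (use assms in auto)

lemma max_0_power_deriv:
  "((\<lambda>w::real. max 0 w ^ (m + 2)) has_real_derivative real (m + 2) * max 0 w ^ (m + 1)) (at w)"
proof (rule linorder_cases[of w 0])
  assume "w < 0"
  then have ev: "\<forall>\<^sub>F v in nhds w. max 0 v ^ (m + 2) = (0::real)"
    by (auto simp: max_def eventually_nhds intro!: exI[of _ "{..<0}"])
  show ?thesis
    using DERIV_cong_ev[OF refl ev refl] \<open>w < 0\<close> by (simp add: max_def)
next
  assume "0 < w"
  then have ev: "\<forall>\<^sub>F v in nhds w. max 0 v ^ (m + 2) = v ^ (m + 2)"
    by (auto simp: max_def eventually_nhds intro!: exI[of _ "{0<..}"])
  have "((\<lambda>v. v ^ (m + 2)) has_real_derivative real (m + 2) * max 0 w ^ (m + 1)) (at w)"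
    using DERIV_pow[of "m + 2" w] \<open>0 < w\<close> by (simp add: max_def)
  then show ?thesis
    using DERIV_cong_ev[OF refl ev refl] by blast
next
  assume w: "w = 0"
  have "((\<lambda>h. max 0 h ^ (m + 2) / h) \<longlongrightarrow> 0) (at (0::real))"
  proof (rule Lim_null_comparison)
    show "\<forall>\<^sub>F h in at 0. norm (max 0 h ^ (m + 2) / h) \<le> \<bar>h\<bar> ^ (m + 1)"
    proof (rule always_eventually, rule allI)
      fix h :: real
      have "max 0 h ^ (m + 2) / h = (if 0 < h then h ^ (m + 1) else 0)"
        by (auto simp: max_def)
      then show "norm (max 0 h ^ (m + 2) / h) \<le> \<bar>h\<bar> ^ (m + 1)"
        by (simp del: power_Suc add: zero_le_power)
    qed
    have "((\<lambda>h::real. \<bar>h\<bar> ^ (m + 1)) \<longlongrightarrow> \<bar>0\<bar> ^ (m + 1)) (at 0)" by (intro tendsto_intros)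
    then show "((\<lambda>h::real. \<bar>h\<bar> ^ (m + 1)) \<longlongrightarrow> 0) (at 0)" by simp
  qed
  then show ?thesis by (simp add: w DERIV_def)
qed

lemma bump_power_deriv:
  "((\<lambda>s. bump (x + s *\<^sub>R b) ^ (m + 2)) has_real_derivative
     - 2 * real (m + 2) * bump x ^ (m + 1) * (x \<bullet> b)) (at 0)"
proof -
  have "((\<lambda>s. 9/4 - (x + s *\<^sub>R b) \<bullet> (x + s *\<^sub>R b)) has_real_derivative - 2 * (x \<bullet> b)) (at 0)"
    by (auto intro!: derivative_eq_intros simp: inner_add algebra_simps inner_commute)
  then show ?thesis
    unfolding bump_def by (rule DERIV_cong[OF DERIV_chain2[OF max_0_power_deriv]]) (simp add: algebra_simps)
qed

lemma reg_dist_deriv: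
  assumes "\<epsilon> \<noteq> 0"
  shows "((\<lambda>s. reg_dist \<epsilon> (x + s *\<^sub>R b) y) has_real_derivative
     ((x - y) \<bullet> b) / reg_dist \<epsilon> x y) (at 0)"
proof -
  define g where "g s = (x + s *\<^sub>R b - y) \<bullet> (x + s *\<^sub>R b - y) + \<epsilon>\<^sup>2" for s
  have g: "(g has_real_derivative 2 * ((x - y) \<bullet> b)) (at 0)"
    unfolding g_def[abs_def]
    by (auto intro!: derivative_eq_intros simp: inner_add inner_diff algebra_simps inner_commute)
  have "0 < g 0" using assms by (simp add: g_def add_nonneg_pos)
  from DERIV_chain2[OF DERIV_real_sqrt[OF this] g]
  have "((\<lambda>s. sqrt (g s)) has_real_derivative ((x - y) \<bullet> b) / sqrt (g 0)) (at 0)"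
    by (simp add: field_simps)
  then show ?thesis by (simp add: reg_dist_def g_def)
qed

lemma kernel_deriv:
  assumes "\<epsilon> \<noteq> 0"
  shows "((\<lambda>s. radial_kernel j (reg_dist \<epsilon> (x + s *\<^sub>R b) y)) has_real_derivative
     ((x - y) \<bullet> b) / reg_dist \<epsilon> x y ^ (j + 1)) (at 0)"
proof -
  have "(radial_kernel j has_real_derivative 1 / reg_dist \<epsilon> (x + 0 *\<^sub>R b) y ^ j)
      (at (reg_dist \<epsilon> (x + 0 *\<^sub>R b) y))"
    by (intro radial_kernel_deriv reg_dist_pos assms)
  from DERIV_chain2[OF this reg_dist_deriv[OF assms]] show ?thesis by (simp add: mult.commute)
qed

lemma kernel_deriv2:
  assumes "\<epsilon> \<noteq> 0" and b: "b \<in> Basis"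
  shows "((\<lambda>s. ((x + s *\<^sub>R b - y) \<bullet> b) / reg_dist \<epsilon> (x + s *\<^sub>R b) y ^ (j + 1)) has_real_derivative
     1 / reg_dist \<epsilon> x y ^ (j + 1) - real (j + 1) * ((x - y) \<bullet> b)\<^sup>2 / reg_dist \<epsilon> x y ^ (j + 3)) (at 0)"
proof -
  define r where "r = reg_dist \<epsilon> x y"
  have r: "r > 0" using assms by (simp add: r_def reg_dist_pos)
  have 1: "((\<lambda>s. (x + s *\<^sub>R b - y) \<bullet> b) has_real_derivative 1) (at 0)"
    using b by (auto intro!: derivative_eq_intros simp: inner_add_left inner_diff_left)
  have 2: "((\<lambda>s. reg_dist \<epsilon> (x + s *\<^sub>R b) y ^ (j + 1)) has_real_derivative
      real (j + 1) * (((x - y) \<bullet> b) / r) * r ^ j) (at 0)"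
    using DERIV_power[OF reg_dist_deriv[OF assms(1), of x b y], of "j + 1"] by (simp add: r_def mult_ac)
  have "(1 * r ^ (j + 1) - ((x - y) \<bullet> b) * (real (j + 1) * (((x - y) \<bullet> b) / r) * r ^ j)) / (r ^ (j + 1) * r ^ (j + 1))
      = 1 / r ^ (j + 1) - real (j + 1) * ((x - y) \<bullet> b)\<^sup>2 / r ^ (j + 3)"
    using r by (simp add: field_simps power2_eq_square eval_nat_numeral)
  then show ?thesis
    using DERIV_divide[OF 1 2] r by (simp add: r_def)
qed

lemma bump_power_deriv2:
  assumes b: "b \<in> Basis"
  shows "((\<lambda>s. - 2 * real (m + 3) * bump (x + s *\<^sub>R b) ^ (m + 2) * ((x + s *\<^sub>R b) \<bullet> b)) has_real_derivative
     4 * real (m + 3) * real (m + 2) * bump x ^ (m + 1) * (x \<bullet> b)\<^sup>2 - 2 * real (m + 3) * bump x ^ (m + 2)) (at 0)"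
proof -
  have "((\<lambda>s. (x + s *\<^sub>R b) \<bullet> b) has_real_derivative 1) (at 0)"
    using b by (auto intro!: derivative_eq_intros simp: inner_add_left)
  from DERIV_cmult[OF DERIV_mult[OF bump_power_deriv[of x b m] this], of "- 2 * real (m + 3)"]
  show ?thesis by (simp add: algebra_simps power2_eq_square)
qed

text \<open>
  The Laplacian in \<open>x\<close> of \<open>radial_kernel j (reg_dist \<epsilon> x y)\<close>.
\<close>

definition kernel_laplacian :: "nat \<Rightarrow> real \<Rightarrow> 'a::euclidean_space \<Rightarrow> 'a \<Rightarrow> real" where
  "kernel_laplacian j \<epsilon> x y =
     ((real DIM('a) - real j - 1) * ((x - y) \<bullet> (x - y)) + real DIM('a) * \<epsilon>\<^sup>2) / reg_dist \<epsilon> x y ^ (j + 3)"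

text \<open>
  The terms of the Laplacian of \<open>\<eta> k\<close> that contain derivatives of the cutoff
  \<open>\<eta> = bump x ^ (2 * j + 3)\<close>, namely \<open>k \<Delta>\<eta> + 2 \<nabla>\<eta> \<cdot> \<nabla>k\<close>.
\<close>

definition cutoff_error :: "nat \<Rightarrow> real \<Rightarrow> 'a::euclidean_space \<Rightarrow> 'a \<Rightarrow> real" where
  "cutoff_error j \<epsilon> x y =
     (4 * real (2 * j + 3) * real (2 * j + 2) * bump x ^ (2 * j + 1) * (x \<bullet> x)
        - 2 * real (2 * j + 3) * real DIM('a) * bump x ^ (2 * j + 2)) * radial_kernel j (reg_dist \<epsilon> x y)
     - 4 * real (2 * j + 3) * bump x ^ (2 * j + 2) * (x \<bullet> (x - y)) / reg_dist \<epsilon> x y ^ (j + 1)"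

text \<open>
  The test function is \<open>\<eta> k\<close>, whose Laplacian is \<open>\<eta> \<Delta>k\<close> plus the cutoff error.
\<close>

lemma green_kernel:
  fixes f :: "'a::euclidean_space \<Rightarrow> real" and f1 f2 :: "'a \<Rightarrow> 'a \<Rightarrow> real"
  assumes \<epsilon>: "\<epsilon> \<noteq> 0"
    and f: "continuous_on (ball 0 2) f" "\<And>b. b \<in> Basis \<Longrightarrow> continuous_on (ball 0 2) (f1 b)"
      "\<And>b. b \<in> Basis \<Longrightarrow> continuous_on (ball 0 2) (f2 b)"
    and df: "\<And>b x. b \<in> Basis \<Longrightarrow> x \<in> ball 0 2 \<Longrightarrow> ((\<lambda>s. f (x + s *\<^sub>R b)) has_real_derivative f1 b x) (at 0)"
      "\<And>b x. b \<in> Basis \<Longrightarrow> x \<in> ball 0 2 \<Longrightarrow> ((\<lambda>s. f1 b (x + s *\<^sub>R b)) has_real_derivative f2 b x) (at 0)"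
  shows "(LINT x:cball 0 2|lborel. bump x ^ (2 * j + 3) * radial_kernel j (reg_dist \<epsilon> x y) * (\<Sum>b\<in>Basis. f2 b x)) =
     (LINT x:cball 0 2|lborel. f x * (bump x ^ (2 * j + 3) * kernel_laplacian j \<epsilon> x y + cutoff_error j \<epsilon> x y))"
proof -
  define m where "m = 2 * j"
  define r where "r x = reg_dist \<epsilon> x y" for x
  have r: "r x > 0" for x using \<epsilon> by (simp add: r_def reg_dist_pos)
  have rn: "r x \<noteq> 0" for x using r[of x] by simp
  have contr: "continuous_on S r" for S unfolding r_def by (intro continuous_intros)
  define k where "k x = radial_kernel j (r x)" for x
  define k1 where "k1 b x = ((x - y) \<bullet> b) / r x ^ (j + 1)" for b x
  define k2 where "k2 b x = 1 / r x ^ (j + 1) - real (j + 1) * ((x - y) \<bullet> b)\<^sup>2 / r x ^ (j + 3)" for b x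
  define e where "e x = bump x ^ (m + 3)" for x :: 'a
  define e1 where "e1 b x = - 2 * real (m + 3) * bump x ^ (m + 2) * (x \<bullet> b)" for b x :: 'a
  define e2 where "e2 b x = 4 * real (m + 3) * real (m + 2) * bump x ^ (m + 1) * (x \<bullet> b)\<^sup>2
      - 2 * real (m + 3) * bump x ^ (m + 2)" for b x :: 'a
  define \<phi> where "\<phi> x = e x * k x" for x
  define \<phi>1 where "\<phi>1 b x = e1 b x * k x + e x * k1 b x" for b x
  define \<phi>2 where "\<phi>2 b x = e2 b x * k x + 2 * e1 b x * k1 b x + e x * k2 b x" for b x
  have contk: "continuous_on UNIV k" "continuous_on UNIV (k1 b)" "continuous_on UNIV (k2 b)" for b
    unfolding k_def k1_def k2_def by (intro continuous_intros contr; simp add: r rn)+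
  have conte: "continuous_on UNIV e" "continuous_on UNIV (e1 b)" "continuous_on UNIV (e2 b)" for b
    unfolding e_def e1_def e2_def by (intro continuous_intros)+
  have de: "((\<lambda>s. e (x + s *\<^sub>R b)) has_real_derivative e1 b x) (at 0)" for b x
    using bump_power_deriv[of x b "m + 1"] by (simp add: e_def e1_def eval_nat_numeral)
  have de1: "((\<lambda>s. e1 b (x + s *\<^sub>R b)) has_real_derivative e2 b x) (at 0)" if "b \<in> Basis" for b x
    using bump_power_deriv2[OF that, of m x] by (simp add: e2_def e1_def)
  have dk: "((\<lambda>s. k (x + s *\<^sub>R b)) has_real_derivative k1 b x) (at 0)" for b x
    using kernel_deriv[OF \<epsilon>] by (simp add: k_def k1_def r_def)
  have dk1: "((\<lambda>s. k1 b (x + s *\<^sub>R b)) has_real_derivative k2 b x) (at 0)" if "b \<in> Basis" for b x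
    using kernel_deriv2[OF \<epsilon> that, of x y j] by (simp add: k1_def k2_def r_def)
  have "(LINT x:cball 0 2|lborel. \<phi> x * (\<Sum>b\<in>Basis. f2 b x)) =
      (LINT x:cball 0 2|lborel. f x * (\<Sum>b\<in>Basis. \<phi>2 b x))"
  proof (rule green_identity[where R = "3/2" and ?\<phi>1.0 = \<phi>1 and ?f1.0 = f1])
    show "((\<lambda>s. \<phi> (x + s *\<^sub>R b)) has_real_derivative \<phi>1 b x) (at 0)" for b x
      unfolding \<phi>_def \<phi>1_def by (rule derivative_eq_intros de dk refl)+ simp
    show "((\<lambda>s. \<phi>1 b (x + s *\<^sub>R b)) has_real_derivative \<phi>2 b x) (at 0)" if "b \<in> Basis" for b x
      unfolding \<phi>1_def \<phi>2_def
      by (rule derivative_eq_intros de de1[OF that] dk dk1[OF that] refl)+ (simp add: algebra_simps)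
  qed (auto intro!: f df continuous_intros contk conte
        simp: \<phi>_def[abs_def] \<phi>1_def[abs_def] \<phi>2_def[abs_def] e_def e1_def e2_def bump_eq_0)
  moreover have "(\<Sum>b\<in>Basis. \<phi>2 b x) = e x * kernel_laplacian j \<epsilon> x y + cutoff_error j \<epsilon> x y" for x
  proof -
    have sq: "(\<Sum>b\<in>Basis. (z \<bullet> b)\<^sup>2) = z \<bullet> z" for z :: 'a
      by (subst euclidean_inner) (simp add: power2_eq_square)
    have s1: "(\<Sum>b\<in>Basis. e2 b x) = 4 * real (m + 3) * real (m + 2) * bump x ^ (m + 1) * (x \<bullet> x)
        - 2 * real (m + 3) * real DIM('a) * bump x ^ (m + 2)"
      unfolding e2_def sum_subtractf by (simp add: sum_distrib_left[symmetric] sq)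
    have "(\<Sum>b\<in>Basis. e1 b x * k1 b x) =
        (\<Sum>b\<in>Basis. (- 2 * real (m + 3) * bump x ^ (m + 2) / r x ^ (j + 1)) * ((x \<bullet> b) * ((x - y) \<bullet> b)))"
      by (simp add: e1_def k1_def field_simps)
    also have "\<dots> = (- 2 * real (m + 3) * bump x ^ (m + 2) / r x ^ (j + 1)) * (x \<bullet> (x - y))"
      by (simp only: sum_distrib_left[symmetric] euclidean_inner[of x "x - y"])
    finally have F: "(\<Sum>b\<in>Basis. e1 b x * k1 b x) = \<dots>" .
    have s2: "2 * (\<Sum>b\<in>Basis. e1 b x * k1 b x) =
        - (4 * real (m + 3) * bump x ^ (m + 2) * (x \<bullet> (x - y)) / r x ^ (j + 1))"
    proof -
      have "2 * (- 2 * a * p / q * w) = - (4 * a * p * w / q)" for a p q w :: real by simp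
      then show ?thesis unfolding F .
    qed
    have "(\<Sum>b\<in>Basis. k2 b x) = real DIM('a) / r x ^ (j + 1)
        - (\<Sum>b\<in>Basis. (real (j + 1) / r x ^ (j + 3)) * ((x - y) \<bullet> b)\<^sup>2)"
      unfolding k2_def sum_subtractf by simp
    also have "\<dots> = real DIM('a) / r x ^ (j + 1) - (real (j + 1) / r x ^ (j + 3)) * ((x - y) \<bullet> (x - y))"
      by (simp only: sum_distrib_left[symmetric] sq)
    also have "\<dots> = (real DIM('a) * (r x)\<^sup>2 - real (j + 1) * ((x - y) \<bullet> (x - y))) / r x ^ (j + 3)"
      using rn[of x] by (simp add: field_simps power2_eq_square eval_nat_numeral)
    also have "\<dots> = kernel_laplacian j \<epsilon> x y"
      unfolding kernel_laplacian_def r_def reg_dist_sq by (simp add: algebra_simps)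
    finally have s3: "(\<Sum>b\<in>Basis. k2 b x) = kernel_laplacian j \<epsilon> x y" .
    have "(\<Sum>b\<in>Basis. \<phi>2 b x) = (\<Sum>b\<in>Basis. e2 b x) * k x + 2 * (\<Sum>b\<in>Basis. e1 b x * k1 b x)
        + e x * (\<Sum>b\<in>Basis. k2 b x)"
      by (simp add: \<phi>2_def sum.distrib sum_distrib_left sum_distrib_right mult.assoc)
    then show ?thesis
      unfolding s1 s2 s3 cutoff_error_def by (simp add: k_def r_def m_def)
  qed
  ultimately show ?thesis by (simp add: \<phi>_def e_def k_def r_def m_def)
qed

definition cutoff_const :: "nat \<Rightarrow> nat \<Rightarrow> real" where
  "cutoff_const j N = 5 * (9 * real (2 * j + 3) * real (2 * j + 2) + 5 * real (2 * j + 3) * real N)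
     + 14 * real (2 * j + 3)"

text \<open>
  Both \<open>k\<close> and \<open>\<nabla>k\<close> are of size \<open>r\<^sup>-\<^sup>j\<close>, and two powers of the bump are lost, so the error is
  controlled by the density of the energy of order \<open>j\<close>.
\<close>

lemma cutoff_error_bound:
  fixes x y :: "'a::euclidean_space"
  assumes \<epsilon>: "\<epsilon> \<noteq> 0" "\<bar>\<epsilon>\<bar> \<le> 1" and xy: "norm x \<le> 2" "norm y \<le> 2"
  shows "\<bar>cutoff_error j \<epsilon> x y\<bar> \<le> cutoff_const j DIM('a) * bump x ^ (2 * j + 1) / reg_dist \<epsilon> x y ^ j"
proof (cases "bump x = 0")
  case True
  then show ?thesis by (simp add: cutoff_error_def)
next
  case False
  define r z n where "r = reg_dist \<epsilon> x y" and "z = bump x ^ (2 * j + 1)" and "n = real (2 * j + 3)"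
  define N where "N = real DIM('a)"
  have r: "0 < r" "r \<le> 5" using \<epsilon> xy by (auto simp: r_def reg_dist_pos reg_dist_le)
  have z: "0 \<le> z" and n: "0 \<le> n" and N: "0 \<le> N" by (auto simp: z_def n_def N_def)
  have nx: "norm x \<le> 3/2" using False by (rule norm_le_if_bump)
  then have xx: "x \<bullet> x \<le> 9/4" using power_mono[of "norm x" "3/2" 2]
    by (simp add: power2_norm_eq_inner[symmetric] power2_eq_square)
  have bz: "bump x ^ (2 * j + 2) = z * bump x" by (simp add: z_def)
  define k where "k = radial_kernel j r"
  have k: "\<bar>k\<bar> \<le> 5 / r ^ j" using radial_kernel_bounds[OF r, of j] by (simp add: k_def)
  have c0: "0 \<le> 4 * n * real (2 * j + 2) * z"
    using n z by (intro mult_nonneg_nonneg) auto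
  have "\<bar>4 * n * real (2 * j + 2) * z * (x \<bullet> x)\<bar> \<le> 4 * n * real (2 * j + 2) * z * (9/4)"
    using mult_left_mono[OF xx c0] mult_nonneg_nonneg[OF c0 inner_ge_zero[of x]] by linarith
  moreover have c1: "0 \<le> 2 * n * N * z"
    using n z N by (intro mult_nonneg_nonneg) auto
  have "\<bar>2 * n * N * (z * bump x)\<bar> \<le> 2 * n * N * (z * (9/4))"
    using mult_left_mono[OF bump_le[of x] c1] mult_nonneg_nonneg[OF c1 bump_nonneg[of x]] by linarith
  moreover have "0 \<le> n * N * z" using n N z by simp
  ultimately have a: "\<bar>4 * n * real (2 * j + 2) * z * (x \<bullet> x) - 2 * n * N * (z * bump x)\<bar>
      \<le> (9 * n * real (2 * j + 2) + 5 * n * N) * z"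
    by (simp add: algebra_simps)
  have A: "\<bar>(4 * n * real (2 * j + 2) * z * (x \<bullet> x) - 2 * n * N * (z * bump x)) * k\<bar>
      \<le> ((9 * n * real (2 * j + 2) + 5 * n * N) * z) * (5 / r ^ j)"
    unfolding abs_mult using a k n z N by (intro mult_mono) auto
  have "\<bar>x \<bullet> (x - y)\<bar> \<le> norm x * norm (x - y)" by (rule Cauchy_Schwarz_ineq2)
  also have "\<dots> \<le> 3/2 * r"
    using nx norm_le_reg_dist[of x y \<epsilon>] by (intro mult_mono) (auto simp: r_def)
  finally have c: "\<bar>x \<bullet> (x - y)\<bar> / r ^ (j + 1) \<le> (3/2 * r) / r ^ (j + 1)"
    using r by (intro divide_right_mono) auto
  then have c: "\<bar>x \<bullet> (x - y)\<bar> / r ^ (j + 1) \<le> 3/2 / r ^ j"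
    using r by simp
  have "\<bar>4 * n * (z * bump x) * (x \<bullet> (x - y)) / r ^ (j + 1)\<bar>
      = 4 * n * (z * bump x) * (\<bar>x \<bullet> (x - y)\<bar> / r ^ (j + 1))"
    using n z r by (simp add: abs_mult)
  also have "\<dots> \<le> 4 * n * (z * (9/4)) * (3/2 / r ^ j)"
    using n z r c bump_le[of x] by (intro mult_mono) auto
  also have "\<dots> \<le> 14 * n * z / r ^ j"
    using n z r by (simp add: field_simps)
  finally have B: "\<bar>4 * n * (z * bump x) * (x \<bullet> (x - y)) / r ^ (j + 1)\<bar> \<le> 14 * n * z / r ^ j" .
  have "cutoff_error j \<epsilon> x y = (4 * n * real (2 * j + 2) * z * (x \<bullet> x) - 2 * n * N * (z * bump x)) * k
      - 4 * n * (z * bump x) * (x \<bullet> (x - y)) / r ^ (j + 1)"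
    unfolding cutoff_error_def bz by (simp add: r_def z_def n_def N_def k_def)
  then have "\<bar>cutoff_error j \<epsilon> x y\<bar> \<le> ((9 * n * real (2 * j + 2) + 5 * n * N) * z) * (5 / r ^ j) + 14 * n * z / r ^ j"
    using A B by linarith
  also have "\<dots> = (5 * (9 * n * real (2 * j + 2) + 5 * n * N) + 14 * n) * z / r ^ j"
    by (simp add: add_divide_distrib algebra_simps)
  also have "\<dots> = cutoff_const j DIM('a) * z / r ^ j"
    by (simp add: cutoff_const_def n_def N_def)
  finally show ?thesis by (simp add: z_def r_def)
qed

text \<open>
  Below the critical order the coefficient \<open>N - j - 1\<close> of \<open>\<bar>x - y\<bar>\<^sup>2\<close> is at least \<open>1\<close>, which gives a
  lower bound that does not degenerate as \<open>\<epsilon> \<rightarrow> 0\<close>.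
\<close>

lemma kernel_laplacian_lower:
  fixes x y :: "'a::euclidean_space"
  assumes \<epsilon>: "\<epsilon> \<noteq> 0" and j: "j + 1 < DIM('a)"
  shows "1 / reg_dist \<epsilon> x y ^ (j + 1) \<le> kernel_laplacian j \<epsilon> x y"
proof -
  define r where "r = reg_dist \<epsilon> x y"
  have r: "r > 0" using \<epsilon> by (simp add: r_def reg_dist_pos)
  have "r\<^sup>2 = 1 * ((x - y) \<bullet> (x - y)) + 1 * \<epsilon>\<^sup>2" by (simp add: r_def reg_dist_sq)
  also have "\<dots> \<le> (real DIM('a) - real j - 1) * ((x - y) \<bullet> (x - y)) + real DIM('a) * \<epsilon>\<^sup>2"
    using j by (intro add_mono mult_right_mono) auto
  finally have "r\<^sup>2 / r ^ (j + 3) \<le> kernel_laplacian j \<epsilon> x y"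
    unfolding kernel_laplacian_def r_def[symmetric] using r by (intro divide_right_mono) auto
  moreover have "r\<^sup>2 / r ^ (j + 3) = 1 / r ^ (j + 1)"
    using r by (simp add: field_simps power2_eq_square eval_nat_numeral)
  ultimately show ?thesis by (simp add: r_def)
qed

lemma kernel_laplacian_nonneg:
  fixes x y :: "'a::euclidean_space"
  assumes "j + 1 \<le> DIM('a)"
  shows "0 \<le> kernel_laplacian j \<epsilon> x y"
  unfolding kernel_laplacian_def reg_dist_def using assms by (intro divide_nonneg_nonneg add_nonneg_nonneg mult_nonneg_nonneg) auto

section \<open>The energy inequality for one kernel\<close>

text \<open>
  The equation holds only for times in the open interval, whereas the integrals are taken over compact
  sets, on which continuous functions are integrable.
\<close>

lemma set_integral_open_cong:
  fixes F G :: "real \<Rightarrow> real"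
  assumes "set_integrable lborel {a..b} F" "set_integrable lborel {a..b} G"
    and "\<And>t. a < t \<Longrightarrow> t < b \<Longrightarrow> F t = G t"
  shows "(LINT t:{a..b}|lborel. F t) = (LINT t:{a..b}|lborel. G t)"
  unfolding set_lebesgue_integral_def
proof (rule integral_cong_AE)
  show "AE t in lborel. indicat_real {a..b} t *\<^sub>R F t = indicat_real {a..b} t *\<^sub>R G t"
    using AE_lborel_singleton[of a] AE_lborel_singleton[of b]
    by eventually_elim (use assms(3) in \<open>force simp: indicator_def\<close>)
qed (use assms(1,2) in \<open>auto simp: set_integrable_def\<close>)

definition space_time :: "(real \<times> 'a::euclidean_space \<times> 'a) set" where
  "space_time = {-4..0} \<times> (cball 0 2 \<times> cball 0 2)"

lemma compact_space_time: "compact space_time"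
  by (simp add: space_time_def compact_Times)

lemma
  fixes f g :: "real \<times> 'a::euclidean_space \<times> 'a \<Rightarrow> real"
  assumes f: "continuous_on space_time f" and g: "continuous_on space_time g"
  shows space_time_integral_cong_fst:
      "(\<And>t y. -4 < t \<Longrightarrow> t < 0 \<Longrightarrow> norm y \<le> 2 \<Longrightarrow>
        (LINT x:cball 0 2|lborel. f (t, x, y)) = (LINT x:cball 0 2|lborel. g (t, x, y))) \<Longrightarrow>
       (LINT z:space_time|lborel. f z) = (LINT z:space_time|lborel. g z)"
    and space_time_integral_cong_snd:
      "(\<And>t x. -4 < t \<Longrightarrow> t < 0 \<Longrightarrow> norm x \<le> 2 \<Longrightarrow>
        (LINT y:cball 0 2|lborel. f (t, x, y)) = (LINT y:cball 0 2|lborel. g (t, x, y))) \<Longrightarrow>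
       (LINT z:space_time|lborel. f z) = (LINT z:space_time|lborel. g z)"
proof -
  let ?D = "cball (0::'a) 2"
  have cD: "compact ?D" "compact (?D \<times> ?D)" by (auto intro: compact_Times)
  have slice: "continuous_on (?D \<times> ?D) (\<lambda>p. h (t, p))"
    if "continuous_on space_time h" "t \<in> {-4..0}" for h :: "real \<times> 'a \<times> 'a \<Rightarrow> real" and t
    using that(2) by (intro continuous_on_compose2[OF that(1)] continuous_intros)
      (auto simp: space_time_def)
  note outer = set_integral_Times_fst[OF compact_Icc cD(2), of "-4" 0, folded space_time_def]
  have red: "(LINT z:space_time|lborel. f z) = (LINT z:space_time|lborel. g z)"
    if "\<And>t. -4 < t \<Longrightarrow> t < 0 \<Longrightarrow>
      (LINT p:?D \<times> ?D|lborel. f (t, p)) = (LINT p:?D \<times> ?D|lborel. g (t, p))"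
    unfolding outer[OF f] outer[OF g]
    using that set_integrable_Times_fst[OF compact_Icc cD(2), of "-4" 0, folded space_time_def] f g
    by (intro set_integral_open_cong) auto
  {
    assume *: "\<And>t y. -4 < t \<Longrightarrow> t < 0 \<Longrightarrow> norm y \<le> 2 \<Longrightarrow>
        (LINT x:?D|lborel. f (t, x, y)) = (LINT x:?D|lborel. g (t, x, y))"
    show "(LINT z:space_time|lborel. f z) = (LINT z:space_time|lborel. g z)"
    proof (rule red)
      fix t :: real assume t: "-4 < t" "t < 0"
      then have t': "t \<in> {-4..0}" by simp
      show "(LINT p:?D \<times> ?D|lborel. f (t, p)) = (LINT p:?D \<times> ?D|lborel. g (t, p))"
        unfolding set_integral_Times_snd[OF cD(1,1) slice[OF f t']]
          set_integral_Times_snd[OF cD(1,1) slice[OF g t']]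
        using *[OF t] by (intro set_lebesgue_integral_cong) auto
    qed
  }
  {
    assume *: "\<And>t x. -4 < t \<Longrightarrow> t < 0 \<Longrightarrow> norm x \<le> 2 \<Longrightarrow>
        (LINT y:?D|lborel. f (t, x, y)) = (LINT y:?D|lborel. g (t, x, y))"
    show "(LINT z:space_time|lborel. f z) = (LINT z:space_time|lborel. g z)"
    proof (rule red)
      fix t :: real assume t: "-4 < t" "t < 0"
      then have t': "t \<in> {-4..0}" by simp
      show "(LINT p:?D \<times> ?D|lborel. f (t, p)) = (LINT p:?D \<times> ?D|lborel. g (t, p))"
        unfolding set_integral_Times_fst[OF cD(1,1) slice[OF f t']]
          set_integral_Times_fst[OF cD(1,1) slice[OF g t']]
        using *[OF t] by (intro set_lebesgue_integral_cong) auto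
    qed
  }
qed

text \<open>
  The part of the problem that the estimates use: \<open>M\<^sub>t = L = \<Delta>u\<close> with \<open>u\<close> comparable to \<open>M\<close>, and
  a bound \<open>S\<close> of the mass. The name \<open>L\<close> stands for the continuous extension to the closed cylinder
  of the common value of \<open>M\<^sub>t\<close> and \<open>\<Delta>u\<close>, which makes \<open>M\<^sub>t\<close> integrable up to the ends of the time
  interval.
\<close>

locale weighted_diffusion =
  fixes M u L :: "real \<times> 'a::euclidean_space \<Rightarrow> real" and lo hi S :: real
  assumes lo_pos: "0 < lo"
    and M_cont: "continuous_on ({-4..0} \<times> cball 0 2) M"
    and u_cont: "continuous_on ({-4..0} \<times> cball 0 2) u"
    and L_cont: "continuous_on ({-4..0} \<times> cball 0 2) L"
    and M_nonneg: "\<And>t x. t \<in> {-4..0} \<Longrightarrow> norm x \<le> 2 \<Longrightarrow> 0 \<le> M (t, x)"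
    and u_lower: "\<And>t x. t \<in> {-4..0} \<Longrightarrow> norm x \<le> 2 \<Longrightarrow> lo * M (t, x) \<le> u (t, x)"
    and u_upper: "\<And>t x. t \<in> {-4..0} \<Longrightarrow> norm x \<le> 2 \<Longrightarrow> u (t, x) \<le> hi * M (t, x)"
    and M_deriv: "\<And>t x. -4 < t \<Longrightarrow> t < 0 \<Longrightarrow> norm x < 2 \<Longrightarrow>
      ((\<lambda>s. M (s, x)) has_real_derivative L (t, x)) (at t)"
    and L_laplacian: "\<And>t. -4 < t \<Longrightarrow> t < 0 \<Longrightarrow> \<exists>u1 u2.
      (\<forall>b\<in>Basis. continuous_on (ball 0 2) (u1 b) \<and> continuous_on (ball 0 2) (u2 b) \<and>
        (\<forall>x\<in>ball 0 2. ((\<lambda>s. u (t, x + s *\<^sub>R b)) has_real_derivative u1 b x) (at 0) \<and>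
           ((\<lambda>s. u1 b (x + s *\<^sub>R b)) has_real_derivative u2 b x) (at 0))) \<and>
      (\<forall>x\<in>ball 0 2. L (t, x) = (\<Sum>b\<in>Basis. u2 b x))"
    and mass: "\<And>t. t \<in> {-4..0} \<Longrightarrow> (LINT x:cball 0 2|lborel. M (t, x)) \<le> S"
begin

lemma continuous_on_slices:
  assumes "continuous_on ({-4..0} \<times> cball 0 2) f"
  shows "continuous_on space_time (\<lambda>z. f (fst z, fst (snd z)))"
    and "continuous_on space_time (\<lambda>z. f (fst z, snd (snd z)))"
    and "t \<in> {-4..0} \<Longrightarrow> continuous_on (cball 0 2) (\<lambda>x. f (t, x))"
    and "norm x \<le> 2 \<Longrightarrow> continuous_on {-4..0} (\<lambda>t. f (t, x))"
  by (auto intro!: continuous_on_compose2[OF assms] continuous_intros simp: space_time_def)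

lemmas continuous_slices =
  continuous_on_slices[OF M_cont] continuous_on_slices[OF u_cont] continuous_on_slices[OF L_cont]

lemma u_nonneg: "t \<in> {-4..0} \<Longrightarrow> norm x \<le> 2 \<Longrightarrow> 0 \<le> u (t, x)"
  using u_lower[of t x] M_nonneg[of t x] lo_pos by (meson mult_nonneg_nonneg less_imp_le order_trans)

lemma green_kernel_solution:
  assumes t: "-4 < t" "t < 0" and \<epsilon>: "\<epsilon> \<noteq> 0"
  shows "(LINT x:cball 0 2|lborel. bump x ^ (2 * j + 3) * radial_kernel j (reg_dist \<epsilon> x y) * L (t, x)) =
     (LINT x:cball 0 2|lborel. u (t, x) * (bump x ^ (2 * j + 3) * kernel_laplacian j \<epsilon> x y + cutoff_error j \<epsilon> x y))"
proof -
  obtain u1 u2 where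
    cu: "\<And>b. b \<in> Basis \<Longrightarrow> continuous_on (ball 0 2) (u1 b)" "\<And>b. b \<in> Basis \<Longrightarrow> continuous_on (ball 0 2) (u2 b)"
    and du: "\<And>b x. b \<in> Basis \<Longrightarrow> x \<in> ball 0 2 \<Longrightarrow> ((\<lambda>s. u (t, x + s *\<^sub>R b)) has_real_derivative u1 b x) (at 0)"
      "\<And>b x. b \<in> Basis \<Longrightarrow> x \<in> ball 0 2 \<Longrightarrow> ((\<lambda>s. u1 b (x + s *\<^sub>R b)) has_real_derivative u2 b x) (at 0)"
    and L: "\<And>x. x \<in> ball 0 2 \<Longrightarrow> L (t, x) = (\<Sum>b\<in>Basis. u2 b x)"
    using L_laplacian[OF t] by blast
  have "(LINT x:cball 0 2|lborel. bump x ^ (2 * j + 3) * radial_kernel j (reg_dist \<epsilon> x y) * L (t, x)) =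
      (LINT x:cball 0 2|lborel. bump x ^ (2 * j + 3) * radial_kernel j (reg_dist \<epsilon> x y) * (\<Sum>b\<in>Basis. u2 b x))"
  proof (rule set_lebesgue_integral_cong, simp, intro allI impI)
    fix x :: 'a
    show "bump x ^ (2 * j + 3) * radial_kernel j (reg_dist \<epsilon> x y) * L (t, x) =
        bump x ^ (2 * j + 3) * radial_kernel j (reg_dist \<epsilon> x y) * (\<Sum>b\<in>Basis. u2 b x)"
      using L[of x] norm_le_if_bump[of x] by (cases "bump x = 0") auto
  qed
  also have "\<dots> = (LINT x:cball 0 2|lborel. u (t, x) *
      (bump x ^ (2 * j + 3) * kernel_laplacian j \<epsilon> x y + cutoff_error j \<epsilon> x y))"
    using t continuous_on_subset[OF continuous_on_slices(3)[OF u_cont, of t] ball_subset_cball]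
    by (intro green_kernel[OF \<epsilon> _ cu du]) auto
  finally show ?thesis .
qed

text \<open>
  The factor \<open>t + 4\<close> and the bumps enter with powers that grow with \<open>j\<close>, since every step of the
  induction spends one of the former and two of the latter at each point.
\<close>

definition energy :: "nat \<Rightarrow> real \<Rightarrow> real" where
  "energy j \<epsilon> = (LINT (t, x, y):space_time|lborel.
     (t + 4) ^ j * (bump x ^ (2 * j + 1) * bump y ^ (2 * j + 1)) * (M (t, x) * M (t, y)) / reg_dist \<epsilon> x y ^ j)"

text \<open>
  The main term in the time derivative of the interaction energy with kernel \<open>radial_kernel j\<close>, with
  \<open>M(x) M(y)\<close> in place of the comparable \<open>u(x) M(y)\<close>.
\<close>

definition dissipation :: "nat \<Rightarrow> real \<Rightarrow> real" where
  "dissipation j \<epsilon> = (LINT (t, x, y):space_time|lborel.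
     (t + 4) ^ (j + 1) * (bump x ^ (2 * j + 3) * bump y ^ (2 * j + 3)) * (M (t, x) * M (t, y))
       * kernel_laplacian j \<epsilon> x y)"

end

definition step_const :: "real \<Rightarrow> nat \<Rightarrow> nat \<Rightarrow> real" where
  "step_const hi N j = 5 * (81/16)\<^sup>2 * real (j + 1) + 8 * (81/16) * hi * cutoff_const j N"

text \<open>
  The pointwise form of the energy step. Here \<open>p\<close> and \<open>q\<close> are the cutoffs of order \<open>j\<close> at the two
  points, \<open>p p2\<close> and \<open>q q2\<close> those of order \<open>j + 1\<close>, \<open>R = r\<^sup>-\<^sup>j\<close>, \<open>\<Lambda>\<close> is the Laplacian of the
  kernel \<open>k\<close>, and \<open>e1\<close>, \<open>e2\<close> are the cutoff errors.
\<close>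

lemma step_inequality:
  fixes \<tau> :: real
  assumes \<tau>: "0 \<le> \<tau>" "\<tau> \<le> 4" and nn: "0 \<le> C" "0 \<le> p" "0 \<le> q" "0 \<le> R" "0 \<le> \<Lambda>"
    and p2: "0 \<le> p2" "p2 \<le> 81/16" and q2: "0 \<le> q2" "q2 \<le> 81/16"
    and m: "0 \<le> m1" "0 \<le> m2" and k: "k \<le> 0" "- k \<le> 5 * R"
    and u: "0 \<le> u1" "0 \<le> u2" "lo * m1 \<le> u1" "lo * m2 \<le> u2" "u1 \<le> hi * m1" "u2 \<le> hi * m2"
    and e: "\<bar>e1\<bar> \<le> C * p * R" "\<bar>e2\<bar> \<le> C * q * R"
  shows "2 * lo * (\<tau> ^ (j + 1) * (p * p2 * (q * q2)) * (m1 * m2) * \<Lambda>)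
      - (5 * (81/16)\<^sup>2 * real (j + 1) + 8 * (81/16) * hi * C) * (\<tau> ^ j * (p * q) * (m1 * m2) * R)
    \<le> real (j + 1) * \<tau> ^ j * (p * p2 * (q * q2)) * k * (m1 * m2)
      + \<tau> ^ (j + 1) * (q * q2) * m2 * (u1 * (p * p2 * \<Lambda> + e1))
      + \<tau> ^ (j + 1) * (p * p2) * m1 * (u2 * (q * q2 * \<Lambda> + e2))"
proof -
  define E where "E = \<tau> ^ j * (p * q) * (m1 * m2)"
  have E: "0 \<le> E" using \<tau> nn m by (simp add: E_def)
  have 1: "p2 * q2 * (- k) * (real (j + 1) * E) \<le> (81/16) * (81/16) * (5 * R) * (real (j + 1) * E)"
    using p2 q2 k E nn by (intro mult_mono mult_nonneg_nonneg) auto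
  have 2: "(lo * m1) * (\<tau> ^ (j + 1) * (q * q2) * m2 * (p * p2 * \<Lambda>)) \<le> u1 * (\<tau> ^ (j + 1) * (q * q2) * m2 * (p * p2 * \<Lambda>))"
    using u m \<tau> nn p2 q2 by (intro mult_right_mono mult_nonneg_nonneg) auto
  have 3: "(lo * m2) * (\<tau> ^ (j + 1) * (q * q2) * m1 * (p * p2 * \<Lambda>)) \<le> u2 * (\<tau> ^ (j + 1) * (q * q2) * m1 * (p * p2 * \<Lambda>))"
    using u m \<tau> nn p2 q2 by (intro mult_right_mono mult_nonneg_nonneg) auto
  have 4: "\<tau> * q2 * (u1 * \<bar>e1\<bar>) * (\<tau> ^ j * q * m2) \<le> 4 * (81/16) * ((hi * m1) * (C * p * R)) * (\<tau> ^ j * q * m2)"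
    using u m \<tau> nn p2 q2 e by (intro mult_mono mult_nonneg_nonneg order_trans[OF u(1) u(5)]) auto
  have 5: "\<tau> * p2 * (u2 * \<bar>e2\<bar>) * (\<tau> ^ j * p * m1) \<le> 4 * (81/16) * ((hi * m2) * (C * q * R)) * (\<tau> ^ j * p * m1)"
    using u m \<tau> nn p2 q2 e by (intro mult_mono mult_nonneg_nonneg order_trans[OF u(2) u(6)]) auto
  have 6: "- (\<tau> * q2 * (u1 * \<bar>e1\<bar>) * (\<tau> ^ j * q * m2)) \<le> \<tau> * q2 * (u1 * e1) * (\<tau> ^ j * q * m2)"
  proof -
    have "0 \<le> \<tau> * q2 * u1 * (\<tau> ^ j * q * m2) * (\<bar>e1\<bar> + e1)"
      using u m \<tau> nn q2 by (intro mult_nonneg_nonneg) auto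
    then show ?thesis by (simp add: algebra_simps)
  qed
  have 7: "- (\<tau> * p2 * (u2 * \<bar>e2\<bar>) * (\<tau> ^ j * p * m1)) \<le> \<tau> * p2 * (u2 * e2) * (\<tau> ^ j * p * m1)"
  proof -
    have "0 \<le> \<tau> * p2 * u2 * (\<tau> ^ j * p * m1) * (\<bar>e2\<bar> + e2)"
      using u m \<tau> nn p2 by (intro mult_nonneg_nonneg) auto
    then show ?thesis by (simp add: algebra_simps)
  qed
  define A where "A = \<tau> ^ (j + 1) * (p * p2 * (q * q2)) * (m1 * m2) * \<Lambda>"
  have F1: "- (5 * (81/16)\<^sup>2 * real (j + 1) * (E * R)) \<le> real (j + 1) * \<tau> ^ j * (p * p2 * (q * q2)) * k * (m1 * m2)"
  proof -
    have "5 * (81/16)\<^sup>2 * real (j + 1) * (E * R) = (81/16) * (81/16) * (5 * R) * (real (j + 1) * E)"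
      by (simp add: power2_eq_square mult_ac)
    moreover have "p2 * q2 * (- k) * (real (j + 1) * E)
        = - (real (j + 1) * \<tau> ^ j * (p * p2 * (q * q2)) * k * (m1 * m2))"
      by (simp add: E_def mult_ac)
    ultimately show ?thesis using 1 by linarith
  qed
  have F2: "lo * A \<le> \<tau> ^ (j + 1) * (q * q2) * m2 * (u1 * (p * p2 * \<Lambda>))"
    using 2 by (simp add: A_def mult_ac)
  have F3: "lo * A \<le> \<tau> ^ (j + 1) * (p * p2) * m1 * (u2 * (q * q2 * \<Lambda>))"
    using 3 by (simp add: A_def mult_ac)
  have F4: "- (4 * (81/16) * hi * C * (E * R)) \<le> \<tau> ^ (j + 1) * (q * q2) * m2 * (u1 * e1)"
  proof -
    have "4 * (81/16) * hi * C * (E * R) = 4 * (81/16) * ((hi * m1) * (C * p * R)) * (\<tau> ^ j * q * m2)"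
      by (simp add: E_def mult_ac)
    moreover have "\<tau> * q2 * (u1 * e1) * (\<tau> ^ j * q * m2) = \<tau> ^ (j + 1) * (q * q2) * m2 * (u1 * e1)"
      by (simp add: mult_ac)
    ultimately show ?thesis using 4 6 by linarith
  qed
  have F5: "- (4 * (81/16) * hi * C * (E * R)) \<le> \<tau> ^ (j + 1) * (p * p2) * m1 * (u2 * e2)"
  proof -
    have "4 * (81/16) * hi * C * (E * R) = 4 * (81/16) * ((hi * m2) * (C * q * R)) * (\<tau> ^ j * p * m1)"
      by (simp add: E_def mult_ac)
    moreover have "\<tau> * p2 * (u2 * e2) * (\<tau> ^ j * p * m1) = \<tau> ^ (j + 1) * (p * p2) * m1 * (u2 * e2)"
      by (simp add: mult_ac)
    ultimately show ?thesis using 5 7 by linarith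
  qed
  have "2 * lo * A - (5 * (81/16)\<^sup>2 * real (j + 1) + 8 * (81/16) * hi * C) * (E * R)
      = lo * A + lo * A - 5 * (81/16)\<^sup>2 * real (j + 1) * (E * R)
        - 4 * (81/16) * hi * C * (E * R) - 4 * (81/16) * hi * C * (E * R)"
    by (simp add: algebra_simps)
  also have "\<dots> \<le> real (j + 1) * \<tau> ^ j * (p * p2 * (q * q2)) * k * (m1 * m2)
      + \<tau> ^ (j + 1) * (q * q2) * m2 * (u1 * (p * p2 * \<Lambda>) + u1 * e1)
      + \<tau> ^ (j + 1) * (p * p2) * m1 * (u2 * (q * q2 * \<Lambda>) + u2 * e2)"
    unfolding distrib_left[of "\<tau> ^ (j + 1) * (q * q2) * m2"] distrib_left[of "\<tau> ^ (j + 1) * (p * p2) * m1"]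
    using F1 F2 F3 F4 F5 by linarith
  finally show ?thesis
    by (simp only: A_def E_def distrib_left[of u1] distrib_left[of u2] mult.assoc[of "\<tau> ^ j * (p * q)"])
qed

context weighted_diffusion
begin

text \<open>
  Differentiate \<open>w = (t + 4)\<^sup>j\<^sup>+\<^sup>1 \<eta>(x) \<eta>(y) k M(x) M(y)\<close> in time and integrate. The value at \<open>t = -4\<close>
  is \<open>0\<close> because of the factor in time and the value at \<open>t = 0\<close> is not positive because \<open>k\<close> is not, so
  the integral of the derivative is not positive. Green's identity in \<open>x\<close> and in \<open>y\<close> moves the Laplacian
  from \<open>u\<close> to the kernel; the main term is the dissipation, and all others are bounded by the energy.
\<close>

lemma dissipation_le_energy:
  assumes \<epsilon>: "0 < \<epsilon>" "\<epsilon> \<le> 1" and j: "j + 1 \<le> DIM('a)"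
  shows "2 * lo * dissipation j \<epsilon> \<le> step_const hi DIM('a) j * energy j \<epsilon>"
proof -
  let ?D = "cball (0::'a) 2"
  define r where "r x y = reg_dist \<epsilon> x y" for x y :: 'a
  define k where "k x y = radial_kernel j (r x y)" for x y
  define e where "e x = bump x ^ (2 * j + 3)" for x :: 'a
  define a where "a = (\<lambda>(t, x, y). real (j + 1) * (t + 4) ^ j * (e x * e y) * k x y * (M (t, x) * M (t, y)))"
  define b1 where "b1 = (\<lambda>(t, x, y). (t + 4) ^ (j + 1) * e y * M (t, y) * (e x * k x y * L (t, x)))"
  define b2 where "b2 = (\<lambda>(t, x, y). (t + 4) ^ (j + 1) * e x * M (t, x) * (e y * k x y * L (t, y)))"
  define c1 where "c1 = (\<lambda>(t, x, y). (t + 4) ^ (j + 1) * e y * M (t, y) *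
    (u (t, x) * (e x * kernel_laplacian j \<epsilon> x y + cutoff_error j \<epsilon> x y)))"
  define c2 where "c2 = (\<lambda>(t, x, y). (t + 4) ^ (j + 1) * e x * M (t, x) *
    (u (t, y) * (e y * kernel_laplacian j \<epsilon> y x + cutoff_error j \<epsilon> y x)))"
  define g where "g = (\<lambda>(t, x, y). (t + 4) ^ j * (bump x ^ (2 * j + 1) * bump y ^ (2 * j + 1)) * (M (t, x) * M (t, y)) / r x y ^ j)"
  define d where "d = (\<lambda>(t, x, y). (t + 4) ^ (j + 1) * (e x * e y) * (M (t, x) * M (t, y)) * kernel_laplacian j \<epsilon> x y)"
  have \<epsilon>0: "\<epsilon> \<noteq> 0" using \<epsilon> by simp
  have rpos: "0 < r x y" and rn': "reg_dist \<epsilon> x y \<noteq> 0" for x y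
    using reg_dist_pos[OF \<epsilon>0, of x y] by (auto simp: r_def)
  have sym: "r x y = r y x" "k x y = k y x" for x y
    by (simp_all add: r_def k_def reg_dist_commute)
  have lsym: "kernel_laplacian j \<epsilon> x y = kernel_laplacian j \<epsilon> y x" for x y :: 'a
  proof -
    have "(x - y) \<bullet> (x - y) = (y - x) \<bullet> (y - x)" by (simp add: inner_diff inner_commute)
    then show ?thesis unfolding kernel_laplacian_def by (simp add: reg_dist_commute[of \<epsilon> x y])
  qed
  have conts: "continuous_on space_time a" "continuous_on space_time b1" "continuous_on space_time b2"
    "continuous_on space_time c1" "continuous_on space_time c2" "continuous_on space_time d" "continuous_on space_time g"
    unfolding a_def b1_def b2_def c1_def c2_def d_def g_def case_prod_beta e_def k_def
      kernel_laplacian_def cutoff_error_def r_def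
    by (intro continuous_intros continuous_slices; simp add: rn' reg_dist_pos \<epsilon>0)+
  note ints = conts[THEN set_integrable_compact[OF compact_space_time]]
  define T where "T f = (LINT z:space_time|lborel. f z)" for f :: "real \<times> 'a \<times> 'a \<Rightarrow> real"
  define w where "w = (\<lambda>(t, x, y). (t + 4) ^ (j + 1) * (e x * e y) * k x y * (M (t, x) * M (t, y)))"
  have dw: "((\<lambda>s. w (s, x, y)) has_real_derivative (a (t, x, y) + b1 (t, x, y) + b2 (t, x, y))) (at t)"
    if t: "-4 < t" "t < 0" for t x y
  \<comment> \<open>\<open>M\<close> is differentiable in time only in the open ball; elsewhere the cutoff makes \<open>w\<close> vanish.\<close>
  proof (cases "bump x = 0 \<or> bump y = 0")
    case True
    then have z: "e x = 0 \<or> e y = 0" by (auto simp: e_def)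
    then have "w (s, x, y) = 0" for s by (auto simp: w_def)
    moreover have "a (t, x, y) + b1 (t, x, y) + b2 (t, x, y) = 0" using z by (auto simp: a_def b1_def b2_def)
    ultimately show ?thesis by simp
  next
    case False
    then have "norm x < 2" "norm y < 2" using norm_le_if_bump[of x] norm_le_if_bump[of y] by auto
    note D = M_deriv[OF t this(1)] M_deriv[OF t this(2)]
    show ?thesis unfolding w_def prod.case
      by (rule derivative_eq_intros D refl)+ (simp add: a_def b1_def b2_def algebra_simps)
  qed
  \<comment> \<open>\<open>a + b1 + b2\<close> is the time derivative of \<open>w\<close>.\<close>
  have "T (\<lambda>z. a z + b1 z + b2 z) \<le> 0"
  proof -
    have cw: "continuous_on {-4..0} (\<lambda>t. w (t, x, y))" if "norm x \<le> 2" "norm y \<le> 2" for x y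
      unfolding w_def using that by (auto intro!: continuous_intros continuous_slices)
    have cs: "continuous_on {-4..0} (\<lambda>t. a (t, x, y) + b1 (t, x, y) + b2 (t, x, y))"
      if "norm x \<le> 2" "norm y \<le> 2" for x y
      using that by (intro continuous_intros continuous_on_compose2[OF conts(1)]
          continuous_on_compose2[OF conts(2)] continuous_on_compose2[OF conts(3)]) (auto simp: space_time_def)
    have "T (\<lambda>z. a z + b1 z + b2 z) =
        (LINT p:?D \<times> ?D|lborel. LINT t:{-4..0}|lborel. a (t, p) + b1 (t, p) + b2 (t, p))"
      unfolding T_def space_time_def
      by (rule set_integral_Times_snd) (auto intro!: compact_Times continuous_intros conts[unfolded space_time_def])
    also have "\<dots> = (LINT p:?D \<times> ?D|lborel. w (0, p) - w (-4, p))"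
    proof (rule set_lebesgue_integral_cong, simp add: borel_Times, safe)
      fix x y :: 'a assume "x \<in> ?D" "y \<in> ?D"
      then show "(LINT t:{-4..0}|lborel. a (t, x, y) + b1 (t, x, y) + b2 (t, x, y)) = w (0, x, y) - w (-4, x, y)"
        by (intro set_integral_derivative_interior cw cs dw) auto
    qed
    also have "\<dots> = (LINT p:?D \<times> ?D|lborel. w (0, p))"
      by (simp add: w_def case_prod_beta)
    also have "\<dots> \<le> 0"
    proof -
      have "w (0, x, y) \<le> 0" if "x \<in> ?D" "y \<in> ?D" for x y
      proof -
        have "k x y \<le> 0" unfolding k_def
          using that \<epsilon> by (intro radial_kernel_bounds rpos) (auto simp: r_def intro!: reg_dist_le)
        moreover have "0 \<le> 4 ^ (j + 1) * (e x * e y) * (M (0, x) * M (0, y))"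
          using that M_nonneg[of 0] by (auto simp: e_def)
        ultimately have "k x y * (4 ^ (j + 1) * (e x * e y) * (M (0, x) * M (0, y))) \<le> 0"
          by (rule mult_nonpos_nonneg)
        then show ?thesis by (simp add: w_def mult_ac)
      qed
      then have "0 \<le> (LINT p:?D \<times> ?D|lborel. - w (0, p))"
        unfolding set_lebesgue_integral_def
        by (intro integral_nonneg_AE AE_I2) (auto simp: indicator_def)
      then show ?thesis by (simp add: set_lebesgue_integral_def)
    qed
    finally show ?thesis .
  qed
  then have "T a + T b1 + T b2 \<le> 0"
    unfolding T_def using ints by (simp add: set_integral_add)
  moreover have "T b1 = T c1"
    unfolding T_def
  proof (rule space_time_integral_cong_fst[OF conts(2,4)])
    fix t :: real and y :: 'a assume t: "-4 < t" "t < 0"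
    show "(LINT x:?D|lborel. b1 (t, x, y)) = (LINT x:?D|lborel. c1 (t, x, y))"
      unfolding b1_def c1_def prod.case set_integral_mult_right
      using green_kernel_solution[OF t \<epsilon>0, of j y] by (simp add: e_def k_def r_def)
  qed
  moreover have "T b2 = T c2"
    unfolding T_def
  proof (rule space_time_integral_cong_snd[OF conts(3,5)])
    fix t :: real and x :: 'a assume t: "-4 < t" "t < 0"
    show "(LINT y:?D|lborel. b2 (t, x, y)) = (LINT y:?D|lborel. c2 (t, x, y))"
      unfolding b2_def c2_def prod.case set_integral_mult_right sym(2)[of x]
      using green_kernel_solution[OF t \<epsilon>0, of j x] by (simp add: e_def k_def r_def)
  qed
  ultimately have upper: "T a + T c1 + T c2 \<le> 0" by simp
  have lower: "T (\<lambda>z. 2 * lo * d z - step_const hi DIM('a) j * g z) \<le> T (\<lambda>z. a z + c1 z + c2 z)"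
    unfolding T_def
  proof (rule set_integral_mono)
    show "set_integrable lborel space_time (\<lambda>z. 2 * lo * d z - step_const hi DIM('a) j * g z)"
      "set_integrable lborel space_time (\<lambda>z. a z + c1 z + c2 z)"
      using conts by (auto intro!: set_integrable_compact compact_space_time continuous_intros)
    fix z :: "real \<times> 'a \<times> 'a" assume "z \<in> space_time"
    then obtain t x y where z: "z = (t, x, y)" and t: "t \<in> {-4..0}" and x: "norm x \<le> 2" and y: "norm y \<le> 2"
      by (auto simp: space_time_def)
    have bs: "(bump v)\<^sup>2 \<le> 81/16" for v :: 'a
      using power_mono[OF bump_le[of v] bump_nonneg, of 2] by (simp add: power2_eq_square)
    have split: "e v = bump v ^ (2 * j + 1) * (bump v)\<^sup>2" for v :: 'a
    proof -
      have n: "2 * j + 3 = (2 * j + 1) + 2" by simp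
      show ?thesis unfolding e_def n by (rule power_add)
    qed
    have r5: "r x y \<le> 5" unfolding r_def using x y \<epsilon> by (intro reg_dist_le) auto
    have "2 * lo * ((t + 4) ^ (j + 1) * (bump x ^ (2 * j + 1) * (bump x)\<^sup>2 * (bump y ^ (2 * j + 1) * (bump y)\<^sup>2))
            * (M (t, x) * M (t, y)) * kernel_laplacian j \<epsilon> x y)
          - (5 * (81/16)\<^sup>2 * real (j + 1) + 8 * (81/16) * hi * cutoff_const j DIM('a)) *
            ((t + 4) ^ j * (bump x ^ (2 * j + 1) * bump y ^ (2 * j + 1)) * (M (t, x) * M (t, y)) * (1 / r x y ^ j))
        \<le> real (j + 1) * (t + 4) ^ j * (bump x ^ (2 * j + 1) * (bump x)\<^sup>2 * (bump y ^ (2 * j + 1) * (bump y)\<^sup>2))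
              * k x y * (M (t, x) * M (t, y))
          + (t + 4) ^ (j + 1) * (bump y ^ (2 * j + 1) * (bump y)\<^sup>2) * M (t, y) *
              (u (t, x) * (bump x ^ (2 * j + 1) * (bump x)\<^sup>2 * kernel_laplacian j \<epsilon> x y + cutoff_error j \<epsilon> x y))
          + (t + 4) ^ (j + 1) * (bump x ^ (2 * j + 1) * (bump x)\<^sup>2) * M (t, x) *
              (u (t, y) * (bump y ^ (2 * j + 1) * (bump y)\<^sup>2 * kernel_laplacian j \<epsilon> x y + cutoff_error j \<epsilon> y x))"
    proof (rule step_inequality)
      show "k x y \<le> 0" "- k x y \<le> 5 * (1 / r x y ^ j)"
        unfolding k_def using radial_kernel_bounds[OF rpos r5, of j] by auto
      show "\<bar>cutoff_error j \<epsilon> x y\<bar> \<le> cutoff_const j DIM('a) * bump x ^ (2 * j + 1) * (1 / r x y ^ j)"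
        using cutoff_error_bound[OF \<epsilon>0 _ x y, of j] \<epsilon> by (simp add: r_def)
      show "\<bar>cutoff_error j \<epsilon> y x\<bar> \<le> cutoff_const j DIM('a) * bump y ^ (2 * j + 1) * (1 / r x y ^ j)"
        using cutoff_error_bound[OF \<epsilon>0 _ y x, of j] \<epsilon> by (simp add: r_def reg_dist_commute[of \<epsilon> y x])
    qed (use t x y rpos[of x y] bs kernel_laplacian_nonneg[OF j] in
        \<open>auto intro!: M_nonneg u_nonneg u_lower u_upper simp: cutoff_const_def\<close>)
    then show "2 * lo * d z - step_const hi DIM('a) j * g z \<le> a z + c1 z + c2 z"
      unfolding z d_def g_def a_def c1_def c2_def prod.case step_const_def split lsym[of y x]
      by (simp only: times_divide_eq_right mult_1_right)
  qed
  have "T (\<lambda>z. 2 * lo * d z - step_const hi DIM('a) j * g z) = 2 * lo * T d - step_const hi DIM('a) j * T g"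
    unfolding T_def using ints by (simp add: set_integral_diff)
  moreover have "T (\<lambda>z. a z + c1 z + c2 z) = T a + T c1 + T c2"
    unfolding T_def using ints by (simp add: set_integral_add)
  ultimately have "2 * lo * T d \<le> step_const hi DIM('a) j * T g"
    using upper lower by linarith
  moreover have "T d = dissipation j \<epsilon>"
    unfolding T_def d_def dissipation_def e_def by (simp add: case_prod_beta)
  moreover have "T g = energy j \<epsilon>"
    unfolding T_def g_def energy_def r_def by (simp add: case_prod_beta)
  ultimately show ?thesis by simp
qed

end

section \<open>From bounded mass to square integrability\<close>

lemma set_integral_mono_subset:
  fixes f :: "'a::euclidean_space \<Rightarrow> real"
  assumes "set_integrable lborel B f" "A \<in> sets lborel" "A \<subseteq> B" "\<And>x. x \<in> B \<Longrightarrow> 0 \<le> f x"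
  shows "(LINT x:A|lborel. f x) \<le> (LINT x:B|lborel. f x)"
  using assms(1) set_integrable_subset[OF assms(1-3)] assms(3,4)
  unfolding set_integrable_def set_lebesgue_integral_def
  by (intro integral_mono) (auto simp: indicator_def)

lemma set_integral_nonneg:
  fixes f :: "'a::euclidean_space \<Rightarrow> real"
  assumes "\<And>x. x \<in> A \<Longrightarrow> 0 \<le> f x"
  shows "0 \<le> (LINT x:A|lborel. f x)"
  unfolding set_lebesgue_integral_def
  by (intro integral_nonneg_AE AE_I2) (auto simp: indicator_def assms)

primrec energy_const :: "real \<Rightarrow> real \<Rightarrow> nat \<Rightarrow> nat \<Rightarrow> real" where
  "energy_const lo hi N 0 = 81 / 4"
| "energy_const lo hi N (Suc j) = \<bar>step_const hi N j\<bar> / (2 * lo) * energy_const lo hi N j"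

context weighted_diffusion
begin

lemma integrand_continuous:
  assumes "\<epsilon> \<noteq> 0"
  shows "continuous_on space_time (\<lambda>(t, x, y). (t + 4) ^ j * (bump x ^ (2 * j + 1) * bump y ^ (2 * j + 1))
      * (M (t, x) * M (t, y)) / reg_dist \<epsilon> x y ^ j)"
    and "continuous_on space_time (\<lambda>(t, x, y). (t + 4) ^ (j + 1) * (bump x ^ (2 * j + 3) * bump y ^ (2 * j + 3))
      * (M (t, x) * M (t, y)) * kernel_laplacian j \<epsilon> x y)"
proof -
  have rn: "reg_dist \<epsilon> x y \<noteq> 0" for x y :: 'a using reg_dist_pos[OF assms, of x y] by simp
  show "continuous_on space_time (\<lambda>(t, x, y). (t + 4) ^ j * (bump x ^ (2 * j + 1) * bump y ^ (2 * j + 1))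
      * (M (t, x) * M (t, y)) / reg_dist \<epsilon> x y ^ j)"
    "continuous_on space_time (\<lambda>(t, x, y). (t + 4) ^ (j + 1) * (bump x ^ (2 * j + 3) * bump y ^ (2 * j + 3))
      * (M (t, x) * M (t, y)) * kernel_laplacian j \<epsilon> x y)"
    unfolding case_prod_beta kernel_laplacian_def
    by (intro continuous_intros continuous_slices; simp add: rn)+
qed

lemma energy_nonneg:
  assumes "0 < \<epsilon>"
  shows "0 \<le> energy j \<epsilon>"
  unfolding energy_def
proof (rule set_integral_nonneg, clarify)
  fix t :: real and x y :: 'a assume "(t, x, y) \<in> space_time"
  then show "0 \<le> (t + 4) ^ j * (bump x ^ (2 * j + 1) * bump y ^ (2 * j + 1)) * (M (t, x) * M (t, y)) / reg_dist \<epsilon> x y ^ j"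
    using reg_dist_pos[of \<epsilon> x y] assms
    by (intro divide_nonneg_nonneg mult_nonneg_nonneg zero_le_power M_nonneg bump_nonneg) (auto simp: space_time_def)
qed

text \<open>
  For \<open>j = 0\<close> the kernel is constant and the energy is a squared mass, up to the cutoffs. The constant
  is the product of the length \<open>4\<close> of the time interval and two factors \<open>9/4\<close> from the bumps.
\<close>

lemma energy_0_le: "energy 0 \<epsilon> \<le> 81/4 * S\<^sup>2"
proof -
  let ?D = "cball (0::'a) 2"
  have cD: "compact ?D" "compact (?D \<times> ?D)" by (auto intro: compact_Times)
  have cM: "continuous_on space_time (\<lambda>z. M (fst z, fst (snd z)) * M (fst z, snd (snd z)))"
    by (intro continuous_intros continuous_slices)
  have sq: "(LINT p:?D \<times> ?D|lborel. M (t, fst p) * M (t, snd p)) = (LINT x:?D|lborel. M (t, x))\<^sup>2"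
    if t: "t \<in> {-4..0}" for t
  proof -
    have "continuous_on (?D \<times> ?D) (\<lambda>p. M (t, fst p) * M (t, snd p))"
      using t by (intro continuous_intros continuous_on_compose2[OF M_cont]) auto
    from set_integral_Times_fst[OF cD(1,1) this] show ?thesis
      by (simp add: power2_eq_square)
  qed
  have "energy 0 \<epsilon> \<le> (LINT z:space_time|lborel. 81/16 * (M (fst z, fst (snd z)) * M (fst z, snd (snd z))))"
    unfolding energy_def case_prod_beta
  proof (rule set_integral_mono)
    show "set_integrable lborel space_time (\<lambda>z. (fst z + 4) ^ 0 * (bump (fst (snd z)) ^ (2 * 0 + 1) *
        bump (snd (snd z)) ^ (2 * 0 + 1)) * (M (fst z, fst (snd z)) * M (fst z, snd (snd z))) /
        reg_dist \<epsilon> (fst (snd z)) (snd (snd z)) ^ 0)"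
      by (simp, intro set_integrable_compact compact_space_time continuous_intros continuous_slices)
    show "set_integrable lborel space_time (\<lambda>z. 81/16 * (M (fst z, fst (snd z)) * M (fst z, snd (snd z))))"
      by (intro set_integrable_compact compact_space_time continuous_on_mult_left cM)
    fix z :: "real \<times> 'a \<times> 'a" assume "z \<in> space_time"
    then have "0 \<le> M (fst z, fst (snd z)) * M (fst z, snd (snd z))"
      using M_nonneg by (auto simp: space_time_def)
    moreover have "bump (fst (snd z)) * bump (snd (snd z)) \<le> 9/4 * (9/4)"
      by (intro mult_mono bump_le) auto
    ultimately show "(fst z + 4) ^ 0 * (bump (fst (snd z)) ^ (2 * 0 + 1) *
        bump (snd (snd z)) ^ (2 * 0 + 1)) * (M (fst z, fst (snd z)) * M (fst z, snd (snd z))) /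
        reg_dist \<epsilon> (fst (snd z)) (snd (snd z)) ^ 0
        \<le> 81/16 * (M (fst z, fst (snd z)) * M (fst z, snd (snd z)))"
      using mult_right_mono[of "bump (fst (snd z)) * bump (snd (snd z))" "81/16"
          "M (fst z, fst (snd z)) * M (fst z, snd (snd z))"] by simp
  qed
  also have "\<dots> = 81/16 * (LINT z:space_time|lborel. M (fst z, fst (snd z)) * M (fst z, snd (snd z)))"
    by simp
  also have "(LINT z:space_time|lborel. M (fst z, fst (snd z)) * M (fst z, snd (snd z)))
      = (LINT t:{-4..0}|lborel. LINT p:?D \<times> ?D|lborel. M (t, fst p) * M (t, snd p))"
    using set_integral_Times_fst[OF compact_Icc cD(2), of "-4" 0, folded space_time_def, OF cM] by simp
  also have "\<dots> = (LINT t:{-4..0}|lborel. (LINT x:?D|lborel. M (t, x))\<^sup>2)"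
  by (rule set_lebesgue_integral_cong) (auto simp: sq)
  also have "\<dots> \<le> (LINT t:{-4..0::real}|lborel. S\<^sup>2)"
  proof (rule set_integral_mono)
    have "continuous_on ({-4..0} \<times> (?D \<times> ?D)) (\<lambda>z. M (fst z, fst (snd z)) * M (fst z, snd (snd z)))"
      using cM by (simp add: space_time_def)
    from set_integrable_Times_fst[OF compact_Icc cD(2) this]
    have "set_integrable lborel {-4..0} (\<lambda>t. LINT p:?D \<times> ?D|lborel. M (t, fst p) * M (t, snd p))"
      by simp
    then show "set_integrable lborel {-4..0} (\<lambda>t. (LINT x:?D|lborel. M (t, x))\<^sup>2)"
      by (subst set_integrable_cong[OF refl refl sq[symmetric]])
    show "set_integrable lborel {-4..0::real} (\<lambda>t. S\<^sup>2)"
      by (intro set_integrable_compact) auto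
    show "(LINT x:?D|lborel. M (t, x))\<^sup>2 \<le> S\<^sup>2" if "t \<in> {-4..0}" for t
      using that M_nonneg by (intro power_mono mass set_integral_nonneg) auto
  qed
  also have "\<dots> = 4 * S\<^sup>2"
    by (simp add: set_integral_const)
  finally show ?thesis by simp
qed

lemma energy_Suc_le_dissipation:
  assumes \<epsilon>: "0 < \<epsilon>" and j: "j + 1 < DIM('a)"
  shows "energy (Suc j) \<epsilon> \<le> dissipation j \<epsilon>"
  unfolding energy_def dissipation_def
proof (rule set_integral_mono)
  have \<epsilon>0: "\<epsilon> \<noteq> 0" using \<epsilon> by simp
  show "set_integrable lborel space_time (\<lambda>(t, x, y). (t + 4) ^ Suc j * (bump x ^ (2 * Suc j + 1) * bump y ^ (2 * Suc j + 1))
      * (M (t, x) * M (t, y)) / reg_dist \<epsilon> x y ^ Suc j)"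
    by (intro set_integrable_compact compact_space_time integrand_continuous \<epsilon>0)
  show "set_integrable lborel space_time (\<lambda>(t, x, y). (t + 4) ^ (j + 1) * (bump x ^ (2 * j + 3) * bump y ^ (2 * j + 3))
      * (M (t, x) * M (t, y)) * kernel_laplacian j \<epsilon> x y)"
    by (intro set_integrable_compact compact_space_time integrand_continuous \<epsilon>0)
  fix z :: "real \<times> 'a \<times> 'a" assume "z \<in> space_time"
  then obtain t x y where z: "z = (t, x, y)" and t: "t \<in> {-4..0}" and xy: "norm x \<le> 2" "norm y \<le> 2"
    by (auto simp: space_time_def)
  have "0 \<le> (t + 4) ^ (j + 1) * (bump x ^ (2 * j + 3) * bump y ^ (2 * j + 3)) * (M (t, x) * M (t, y))"
    using t xy by (intro mult_nonneg_nonneg zero_le_power bump_nonneg M_nonneg) auto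
  from mult_left_mono[OF kernel_laplacian_lower[OF \<epsilon>0 j, of x y] this]
  have "(t + 4) ^ (j + 1) * (bump x ^ (2 * j + 3) * bump y ^ (2 * j + 3)) * (M (t, x) * M (t, y)) / reg_dist \<epsilon> x y ^ (j + 1)
      \<le> (t + 4) ^ (j + 1) * (bump x ^ (2 * j + 3) * bump y ^ (2 * j + 3)) * (M (t, x) * M (t, y)) * kernel_laplacian j \<epsilon> x y"
    by (simp only: times_divide_eq_right mult_1_right)
  moreover have "2 * Suc j + 1 = 2 * j + 3" "Suc j = j + 1" by simp_all
  ultimately show "(case z of (t, x, y) \<Rightarrow> (t + 4) ^ Suc j * (bump x ^ (2 * Suc j + 1) * bump y ^ (2 * Suc j + 1))
      * (M (t, x) * M (t, y)) / reg_dist \<epsilon> x y ^ Suc j)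
    \<le> (case z of (t, x, y) \<Rightarrow> (t + 4) ^ (j + 1) * (bump x ^ (2 * j + 3) * bump y ^ (2 * j + 3))
      * (M (t, x) * M (t, y)) * kernel_laplacian j \<epsilon> x y)"
    unfolding z prod.case by (simp only:)
qed

lemma
  assumes \<epsilon>: "0 < \<epsilon>" "\<epsilon> \<le> 1"
  shows energy_le: "j < DIM('a) \<Longrightarrow> energy j \<epsilon> \<le> energy_const lo hi DIM('a) j * S\<^sup>2"
    and dissipation_le: "j < DIM('a) \<Longrightarrow> dissipation j \<epsilon> \<le> energy_const lo hi DIM('a) (Suc j) * S\<^sup>2"
proof -
  have step: "dissipation j \<epsilon> \<le> energy_const lo hi DIM('a) (Suc j) * S\<^sup>2"
    if j: "j < DIM('a)" and e: "energy j \<epsilon> \<le> energy_const lo hi DIM('a) j * S\<^sup>2" for j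
  proof -
    have "2 * lo * dissipation j \<epsilon> \<le> step_const hi DIM('a) j * energy j \<epsilon>"
      using dissipation_le_energy[OF \<epsilon>, of j] j by simp
    also have "\<dots> \<le> \<bar>step_const hi DIM('a) j\<bar> * (energy_const lo hi DIM('a) j * S\<^sup>2)"
      using e energy_nonneg[OF \<epsilon>(1), of j] by (intro mult_mono) auto
    finally show ?thesis
      using lo_pos by (simp add: field_simps)
  qed
  show en: "energy j \<epsilon> \<le> energy_const lo hi DIM('a) j * S\<^sup>2" if "j < DIM('a)" for j
    using that
  proof (induction j)
    case 0
    then show ?case using energy_0_le by simp
  next
    case (Suc j)
    then have "energy (Suc j) \<epsilon> \<le> dissipation j \<epsilon>"
      by (intro energy_Suc_le_dissipation \<epsilon>) auto
    also have "\<dots> \<le> energy_const lo hi DIM('a) (Suc j) * S\<^sup>2"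
      using Suc by (intro step) auto
    finally show ?case .
  qed
  show "dissipation j \<epsilon> \<le> energy_const lo hi DIM('a) (Suc j) * S\<^sup>2" if "j < DIM('a)" for j
    using that by (intro step en)
qed

end

definition L2_const :: "real \<Rightarrow> real \<Rightarrow> nat \<Rightarrow> real" where
  "L2_const lo hi N = energy_const lo hi N N * 2 ^ (N + 2) / (real N * unit_ball_vol (real N))"

text \<open>
  At the critical order \<open>\<Delta>k = N \<epsilon>\<^sup>2 / r\<^sup>N\<^sup>+\<^sup>2\<close>, and \<open>r \<le> 2 \<epsilon>\<close> at distance at most \<open>\<epsilon>\<close>. The bound is
  a constant divided by the volume of the ball of radius \<open>\<epsilon>\<close>.
\<close>

lemma kernel_concentration:
  fixes x y :: "'a::euclidean_space"
  assumes \<epsilon>: "0 < \<epsilon>" and xy: "norm (x - y) \<le> \<epsilon>"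
  shows "real DIM('a) / (2 ^ (DIM('a) + 2) * \<epsilon> ^ DIM('a)) \<le> kernel_laplacian (DIM('a) - 1) \<epsilon> x y"
proof -
  define N where "N = DIM('a)"
  define r where "r = reg_dist \<epsilon> x y"
  have N: "1 \<le> N" by (simp add: N_def Suc_leI)
  have r: "0 < r" using \<epsilon> by (simp add: r_def reg_dist_pos)
  have "(norm (x - y))\<^sup>2 \<le> \<epsilon>\<^sup>2" using xy by (intro power_mono) auto
  then have "r\<^sup>2 \<le> \<epsilon>\<^sup>2 + \<epsilon>\<^sup>2"
    by (simp add: r_def reg_dist_sq power2_norm_eq_inner[symmetric])
  also have "\<dots> \<le> (2 * \<epsilon>)\<^sup>2" by (simp add: power_mult_distrib)
  finally have "r\<^sup>2 \<le> (2 * \<epsilon>)\<^sup>2" .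
  then have "r \<le> 2 * \<epsilon>" by (rule power2_le_imp_le) (use \<epsilon> in simp)
  then have "r ^ (N + 2) \<le> (2 * \<epsilon>) ^ (N + 2)" using r by (intro power_mono) auto
  then have "real N * \<epsilon>\<^sup>2 / (2 * \<epsilon>) ^ (N + 2) \<le> real N * \<epsilon>\<^sup>2 / r ^ (N + 2)"
    using r \<epsilon> by (intro divide_left_mono) auto
  moreover have "real N * \<epsilon>\<^sup>2 / (2 * \<epsilon>) ^ (N + 2) = real N / (2 ^ (N + 2) * \<epsilon> ^ N)"
    using \<epsilon> by (simp add: power_mult_distrib power_add power2_eq_square field_simps)
  moreover have "kernel_laplacian (N - 1) \<epsilon> x y = real N * \<epsilon>\<^sup>2 / r ^ (N + 2)"
  proof -
    have "real N - real (N - 1) - 1 = 0" "N - 1 + 3 = N + 2" using N by auto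
    then show ?thesis by (simp only: kernel_laplacian_def N_def r_def) simp
  qed
  ultimately show ?thesis by (simp add: N_def)
qed

context weighted_diffusion
begin

text \<open>
  The last dissipation tests \<open>P(t, x) P(t, y)\<close>, where \<open>P\<close> is \<open>M\<close> times a cutoff, against an approximate
  identity. By uniform continuity \<open>P(t, y) \<ge> P(t, x) - \<delta>\<close> for \<open>\<bar>x - y\<bar> \<le> \<epsilon>\<close>, so integrating over
  \<open>y\<close> in that small ball leaves \<open>\<integral>\<integral> P (P - \<delta>)\<close> with a constant that depends neither on \<open>\<epsilon>\<close> nor on
  \<open>\<delta>\<close>; then \<open>\<delta> \<rightarrow> 0\<close>.
\<close>

lemma L2_bound:
  "(LINT z:{-1..0} \<times> cball 0 1|lborel. (M z)\<^sup>2) \<le> L2_const lo hi DIM('a) * S\<^sup>2"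
proof -
  let ?D = "cball (0::'a) 2" and ?B = "cball (0::'a) 1"
  define N where "N = DIM('a)"
  define \<omega> where "\<omega> = unit_ball_vol (real N)"
  have N: "1 \<le> N" by (simp add: N_def Suc_leI)
  have \<omega>: "0 < \<omega>" by (simp add: \<omega>_def unit_ball_vol_pos)
  define P where "P = (\<lambda>(t, x). bump x ^ (2 * N + 1) * M (t, x))"
  have cP: "continuous_on ({-4..0} \<times> ?D) P"
    unfolding P_def case_prod_beta prod.collapse by (intro continuous_intros M_cont)
  have P0: "0 \<le> P (t, x)" if "t \<in> {-4..0}" "norm x \<le> 2" for t x
    using that by (simp add: P_def M_nonneg)
  have cD: "compact ?D" "compact ?B" "compact (?D \<times> ?D)" "compact ({-4..0::real} \<times> ?D)" "compact ({-1..0::real} \<times> ?B)"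
    by (auto intro!: compact_Times)
  have cP': "continuous_on ({-1..0} \<times> ?B) P"
    by (rule continuous_on_subset[OF cP]) auto
  define Q where "Q = (LINT z:{-1..0} \<times> ?B|lborel. P z)"
  define Q2 where "Q2 = (LINT z:{-1..0} \<times> ?B|lborel. (P z)\<^sup>2)"
  define A where "A = L2_const lo hi N * S\<^sup>2"
  have key: "Q2 \<le> A + \<delta> * Q" if \<delta>: "0 < \<delta>" for \<delta>
  proof -
    have "uniformly_continuous_on ({-4..0} \<times> ?D) P"
      by (rule compact_uniformly_continuous[OF cP cD(4)])
    then obtain e where e: "0 < e"
      "\<And>z z'. z \<in> {-4..0} \<times> ?D \<Longrightarrow> z' \<in> {-4..0} \<times> ?D \<Longrightarrow> dist z' z < e \<Longrightarrow> dist (P z') (P z) < \<delta>"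
      unfolding uniformly_continuous_on_def using \<delta> by metis
    define \<epsilon> where "\<epsilon> = min 1 (e / 2)"
    have \<epsilon>: "0 < \<epsilon>" "\<epsilon> \<le> 1" "\<epsilon> < e" using e(1) by (auto simp: \<epsilon>_def)
    define K :: "'a \<Rightarrow> 'a \<Rightarrow> real" where "K = kernel_laplacian (N - 1) \<epsilon>"
    define f where "f = (\<lambda>(t, x, y). (t + 4) ^ N * (P (t, x) * P (t, y)) * K x y)"
    have NN: "N - 1 + 1 = N" "2 * (N - 1) + 3 = 2 * N + 1" using N by auto
    have feq: "f = (\<lambda>(t, x, y). (t + 4) ^ (N - 1 + 1) * (bump x ^ (2 * (N - 1) + 3) * bump y ^ (2 * (N - 1) + 3))
      * (M (t, x) * M (t, y)) * kernel_laplacian (N - 1) \<epsilon> x y)"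
      unfolding f_def P_def K_def NN by (auto simp: fun_eq_iff)
    have cf: "continuous_on space_time f"
      unfolding feq by (rule integrand_continuous) (use \<epsilon> in simp)
    have fD: "(LINT z:space_time|lborel. f z) = dissipation (N - 1) \<epsilon>"
      unfolding feq dissipation_def by simp
    have K0: "0 \<le> K x y" for x y
      unfolding K_def by (rule kernel_laplacian_nonneg) (use N in \<open>simp add: N_def\<close>)
    have f0: "0 \<le> f (t, x, y)" if "t \<in> {-4..0}" "norm x \<le> 2" "norm y \<le> 2" for t x y
      using that P0 K0 by (auto simp: f_def intro!: mult_nonneg_nonneg)
    define c where "c = real N * \<omega> / 2 ^ (N + 2)"
    define h where "h z = P z * (P z - \<delta>) * c" for z
    have inner: "h (t, x) \<le> (LINT y:?D|lborel. f (t, x, y))" if t: "t \<in> {-1..0}" and x: "x \<in> ?B" for t x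
    proof -
      have t4: "t \<in> {-4..0}" and x2: "norm x \<le> 2" using t x by auto
      have sub: "cball x \<epsilon> \<subseteq> ?D"
      proof
        fix y assume "y \<in> cball x \<epsilon>"
        then have "norm (x - y) \<le> 1" using \<epsilon> by (simp add: dist_norm)
        then show "y \<in> ?D" using x norm_triangle_ineq4[of x "x - y"] by simp
      qed
      have cfy: "continuous_on ?D (\<lambda>y. f (t, x, y))"
        using t4 x2 by (intro continuous_on_compose2[OF cf] continuous_intros) (auto simp: space_time_def)
      define k where "k = real N / (2 ^ (N + 2) * \<epsilon> ^ N)"
      have "h (t, x) = (LINT y:cball x \<epsilon>|lborel. P (t, x) * (P (t, x) - \<delta>) * k)"
        using \<epsilon> by (subst set_integral_const) (auto simp: h_def c_def k_def content_cball N_def[symmetric] \<omega>_def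
            emeasure_cball)
      also have "\<dots> \<le> (LINT y:cball x \<epsilon>|lborel. f (t, x, y))"
      proof (rule set_integral_mono)
        show "set_integrable lborel (cball x \<epsilon>) (\<lambda>y. P (t, x) * (P (t, x) - \<delta>) * k)"
          by (intro set_integrable_compact continuous_intros) auto
        show "set_integrable lborel (cball x \<epsilon>) (\<lambda>y. f (t, x, y))"
          by (intro set_integrable_compact continuous_on_subset[OF cfy sub]) auto
        fix y assume y: "y \<in> cball x \<epsilon>"
        then have y2: "norm y \<le> 2" using sub by auto
        have "dist (t, y) (t, x) < e" using y \<epsilon> by (simp add: dist_Pair_Pair dist_commute)
        from e(2)[OF _ _ this] have d: "P (t, x) - \<delta> \<le> P (t, y)"
          using t4 x2 y2 by (simp add: dist_real_def)
        have k: "0 \<le> k" "k \<le> K x y"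
          using kernel_concentration[OF \<epsilon>(1), of x y] y \<epsilon>
          by (auto simp: k_def K_def N_def dist_norm)
        have PP: "0 \<le> P (t, x) * P (t, y)" using P0 t4 x2 y2 by simp
        have "P (t, x) * (P (t, x) - \<delta>) * k \<le> P (t, x) * P (t, y) * k"
          using d k P0[OF t4 x2] by (intro mult_right_mono mult_left_mono)
        also have "\<dots> \<le> P (t, x) * P (t, y) * K x y"
          using k PP by (intro mult_left_mono)
        also have "\<dots> \<le> (t + 4) ^ N * (P (t, x) * P (t, y) * K x y)"
          using mult_right_mono[of 1 "(t + 4) ^ N" "P (t, x) * P (t, y) * K x y"] t PP K0[of x y]
          by (simp add: one_le_power)
        finally show "P (t, x) * (P (t, x) - \<delta>) * k \<le> f (t, x, y)"
          by (simp add: f_def mult_ac)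
      qed
      also have "\<dots> \<le> (LINT y:?D|lborel. f (t, x, y))"
        using sub f0 t4 x2 by (intro set_integral_mono_subset set_integrable_compact cfy) auto
      finally show ?thesis .
    qed
    have ch: "continuous_on ({-1..0} \<times> ?B) h"
      unfolding h_def by (intro continuous_intros cP')
    have mid: "(LINT x:?B|lborel. h (t, x)) \<le> (LINT p:?D \<times> ?D|lborel. f (t, p))" if t: "t \<in> {-1..0}" for t
    proof -
      have t4: "t \<in> {-4..0}" using t by auto
      have cfp: "continuous_on (?D \<times> ?D) (\<lambda>p. f (t, p))"
        using t4 by (intro continuous_on_compose2[OF cf] continuous_intros) (auto simp: space_time_def)
      note I = set_integrable_Times_fst[OF cD(1,1) cfp]
      have "(LINT x:?B|lborel. h (t, x)) \<le> (LINT x:?B|lborel. LINT y:?D|lborel. f (t, x, y))"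
      proof (rule set_integral_mono)
        show "set_integrable lborel ?B (\<lambda>x. h (t, x))"
          using t by (intro set_integrable_compact continuous_on_compose2[OF ch] continuous_intros) auto
        show "set_integrable lborel ?B (\<lambda>x. LINT y:?D|lborel. f (t, x, y))"
          by (rule set_integrable_subset[OF I]) auto
      qed (use inner[OF t] in auto)
      also have "\<dots> \<le> (LINT x:?D|lborel. LINT y:?D|lborel. f (t, x, y))"
        using f0 t4 by (intro set_integral_mono_subset I set_integral_nonneg) auto
      also have "\<dots> = (LINT p:?D \<times> ?D|lborel. f (t, p))"
        by (rule set_integral_Times_fst[OF cD(1,1) cfp, symmetric])
      finally show ?thesis .
    qed
    have cf': "continuous_on ({-4..0} \<times> (?D \<times> ?D)) f" using cf by (simp add: space_time_def)
    note I = set_integrable_Times_fst[OF compact_Icc cD(3) cf']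
    have "(LINT z:{-1..0} \<times> ?B|lborel. h z) = (LINT t:{-1..0}|lborel. LINT x:?B|lborel. h (t, x))"
      by (rule set_integral_Times_fst[OF compact_Icc cD(2) ch])
    also have "\<dots> \<le> (LINT t:{-1..0}|lborel. LINT p:?D \<times> ?D|lborel. f (t, p))"
    proof (rule set_integral_mono)
      show "set_integrable lborel {-1..0} (\<lambda>t. LINT x:?B|lborel. h (t, x))"
        by (rule set_integrable_Times_fst[OF compact_Icc cD(2) ch])
      show "set_integrable lborel {-1..0} (\<lambda>t. LINT p:?D \<times> ?D|lborel. f (t, p))"
        by (rule set_integrable_subset[OF I]) auto
    qed (use mid in auto)
    also have "\<dots> \<le> (LINT t:{-4..0}|lborel. LINT p:?D \<times> ?D|lborel. f (t, p))"
      using f0 by (intro set_integral_mono_subset I set_integral_nonneg) auto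
    also have "\<dots> = (LINT z:space_time|lborel. f z)"
      unfolding space_time_def by (rule set_integral_Times_fst[OF compact_Icc cD(3) cf', symmetric])
    also have "\<dots> = dissipation (N - 1) \<epsilon>" by (rule fD)
    also have "\<dots> \<le> energy_const lo hi N N * S\<^sup>2"
      using dissipation_le[OF \<epsilon>(1,2), of "N - 1"] N by (simp add: N_def)
    finally have "(LINT z:{-1..0} \<times> ?B|lborel. h z) \<le> energy_const lo hi N N * S\<^sup>2" .
    moreover have "(LINT z:{-1..0} \<times> ?B|lborel. h z) = (Q2 - \<delta> * Q) * c"
    proof -
      have "(LINT z:{-1..0} \<times> ?B|lborel. h z) = (LINT z:{-1..0} \<times> ?B|lborel. c * (P z)\<^sup>2 - c * \<delta> * P z)"
        by (simp add: h_def power2_eq_square algebra_simps)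
      also have "\<dots> = (LINT z:{-1..0} \<times> ?B|lborel. c * (P z)\<^sup>2) - (LINT z:{-1..0} \<times> ?B|lborel. c * \<delta> * P z)"
        by (intro set_integral_diff set_integrable_compact cD continuous_intros cP')
      finally show ?thesis by (simp add: Q_def Q2_def algebra_simps)
    qed
    moreover have "A * c = energy_const lo hi N N * S\<^sup>2"
      using \<omega> N by (simp add: A_def L2_const_def c_def \<omega>_def[symmetric])
    moreover have "0 < c" using \<omega> N by (simp add: c_def)
    ultimately have "(Q2 - \<delta> * Q) * c \<le> A * c" by simp
    then have "Q2 - \<delta> * Q \<le> A" using \<open>0 < c\<close> by simp
    then show ?thesis by simp
  qed
  have Q0: "0 \<le> Q" unfolding Q_def using P0 by (intro set_integral_nonneg) auto
  have "Q2 \<le> A"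
  proof (rule field_le_epsilon)
    \<comment> \<open>\<open>Q + 1\<close> instead of \<open>Q\<close>, since \<open>Q\<close> may be \<open>0\<close>.\<close>
    fix e :: real assume "0 < e"
    then have "e / (Q + 1) * Q \<le> e" using Q0 by (simp add: field_simps)
    then show "Q2 \<le> A + e" using key[of "e / (Q + 1)"] \<open>0 < e\<close> Q0 by (simp add: add_pos_nonneg divide_pos_pos order_trans[OF key])
  qed
  moreover have "(LINT z:{-1..0} \<times> ?B|lborel. (M z)\<^sup>2) \<le> Q2"
    unfolding Q2_def
  proof (rule set_integral_mono)
    show "set_integrable lborel ({-1..0} \<times> ?B) (\<lambda>z. (M z)\<^sup>2)"
      by (intro set_integrable_compact cD continuous_intros continuous_on_subset[OF M_cont]) auto
    show "set_integrable lborel ({-1..0} \<times> ?B) (\<lambda>z. (P z)\<^sup>2)"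
      by (intro set_integrable_compact cD continuous_intros cP')
    fix z :: "real \<times> 'a" assume "z \<in> {-1..0} \<times> ?B"
    then obtain t x where z: "z = (t, x)" "t \<in> {-4..0}" "norm x \<le> 1" by auto
    have "x \<bullet> x \<le> 1" using z(3) power_mono[of "norm x" 1 2] by (simp add: power2_norm_eq_inner[symmetric])
    then have "1 \<le> bump x" by (simp add: bump_def)
    then have "1 \<le> bump x ^ (2 * N + 1)" by (rule one_le_power)
    then have "1 * M z \<le> P z" unfolding z P_def prod.case using z by (intro mult_right_mono M_nonneg) auto
    then show "(M z)\<^sup>2 \<le> (P z)\<^sup>2" using z by (intro power_mono) (auto simp: M_nonneg)
  qed
  ultimately show ?thesis by (simp add: A_def N_def)
qed

end

text \<open>
  Integrated over a set of finite measure this replaces Hoelder's inequality. The scale \<open>\<mu>\<close> will be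
  slightly larger than the mass bound, which may be \<open>0\<close>; both terms are then of order
  \<open>\<mu> powr q\<close>.
\<close>

lemma powr_le_of_square:
  fixes m \<mu> q :: real
  assumes "0 \<le> m" "0 < \<mu>" "0 < q" "q \<le> 2"
  shows "m powr q \<le> \<mu> powr q + \<mu> powr (q - 2) * m\<^sup>2"
proof (cases "m \<le> \<mu>")
  case True
  then have "m powr q \<le> \<mu> powr q" using assms by (intro powr_mono2) auto
  moreover have "0 \<le> \<mu> powr (q - 2) * m\<^sup>2" by simp
  ultimately show ?thesis by linarith
next
  case False
  then have m: "0 < m" "\<mu> \<le> m" using assms by auto
  have "m powr q = m powr (q - 2) * m powr 2" by (simp flip: powr_add)
  also have "\<dots> = m powr (q - 2) * m\<^sup>2" using m by (simp add: powr_numeral)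
  also have "\<dots> \<le> \<mu> powr (q - 2) * m\<^sup>2"
    using assms m by (intro mult_right_mono powr_mono2') auto
  finally show ?thesis using assms by (simp add: add_increasing)
qed

context weighted_diffusion
begin

lemma S_nonneg: "0 \<le> S"
  using mass[of 0] set_integral_nonneg[of "cball 0 2" "\<lambda>x. M (0, x)"] M_nonneg[of 0] by force

lemma Lq_bound:
  assumes q: "1 \<le> q" "q \<le> 2"
  shows "Lq_norm q (Q_cyl 1) M \<le> (measure lborel ({-1..0::real} \<times> cball (0::'a) 1) + \<bar>L2_const lo hi DIM('a)\<bar>) powr (1 / q) * S"
proof -
  let ?B = "cball (0::'a) 1"
  define V where "V = measure lborel ({-1..0::real} \<times> ?B)"
  define C where "C = \<bar>L2_const lo hi DIM('a)\<bar>"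
  have cB: "compact ({-1..0::real} \<times> ?B)" by (auto intro: compact_Times)
  have V: "0 \<le> V" and C: "0 \<le> C" by (auto simp: V_def C_def)
  have cM: "continuous_on ({-1..0} \<times> ?B) M" by (rule continuous_on_subset[OF M_cont]) auto
  have iq: "set_integrable lborel ({-1..0} \<times> ?B) (\<lambda>z. \<bar>M z\<bar> powr q)"
    using q by (intro set_integrable_compact cB continuous_on_powr' continuous_intros cM) auto
  note S0 = S_nonneg
  have le: "Lq_norm q (Q_cyl 1) M \<le> (V + C) powr (1 / q) * \<mu>" if \<mu>: "S < \<mu>" for \<mu>
  proof -
    have \<mu>0: "0 < \<mu>" using \<mu> S0 by simp
    have "(LINT z:Q_cyl 1|lborel. \<bar>M z\<bar> powr q) \<le> (LINT z:{-1..0} \<times> ?B|lborel. \<bar>M z\<bar> powr q)"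
      by (intro set_integral_mono_subset iq) (auto simp: Q_cyl_def borel_Times)
    also have "\<dots> \<le> (LINT z:{-1..0} \<times> ?B|lborel. \<mu> powr q + \<mu> powr (q - 2) * (M z)\<^sup>2)"
    proof (rule set_integral_mono[OF iq])
      show "set_integrable lborel ({-1..0} \<times> ?B) (\<lambda>z. \<mu> powr q + \<mu> powr (q - 2) * (M z)\<^sup>2)"
        by (intro set_integrable_compact cB continuous_intros cM)
      show "\<bar>M z\<bar> powr q \<le> \<mu> powr q + \<mu> powr (q - 2) * (M z)\<^sup>2" for z
        using powr_le_of_square[of "\<bar>M z\<bar>" \<mu> q] \<mu>0 q by simp
    qed
    also have "\<dots> = (LINT z:{-1..0::real} \<times> ?B|lborel. \<mu> powr q) + (LINT z:{-1..0} \<times> ?B|lborel. \<mu> powr (q - 2) * (M z)\<^sup>2)"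
      by (intro set_integral_add(2) set_integrable_compact cB continuous_intros cM)
    also have "\<dots> = V * \<mu> powr q + \<mu> powr (q - 2) * (LINT z:{-1..0} \<times> ?B|lborel. (M z)\<^sup>2)"
      using emeasure_compact_finite[OF cB] cB[THEN compact_imp_closed]
      by (subst set_integral_const) (auto simp: V_def borel_closed)
    also have "\<dots> \<le> V * \<mu> powr q + \<mu> powr (q - 2) * (C * \<mu>\<^sup>2)"
    proof -
      have "L2_const lo hi DIM('a) * S\<^sup>2 \<le> C * \<mu>\<^sup>2"
        using \<mu> S0 by (intro mult_mono power_mono) (auto simp: C_def)
      then show ?thesis using L2_bound by (intro add_left_mono mult_left_mono) auto
    qed
    also have "\<dots> = (V + C) * \<mu> powr q"
      using \<mu>0 by (simp add: powr_diff powr_numeral field_simps)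
    finally have "(LINT z:Q_cyl 1|lborel. \<bar>M z\<bar> powr q) powr (1 / q) \<le> ((V + C) * \<mu> powr q) powr (1 / q)"
      using q by (intro powr_mono2 set_integral_nonneg) auto
    also have "\<dots> = (V + C) powr (1 / q) * \<mu>"
      using V C \<mu>0 q by (simp add: powr_mult powr_powr)
    finally show ?thesis by (simp add: Lq_norm_def)
  qed
  have "Lq_norm q (Q_cyl 1) M \<le> (V + C) powr (1 / q) * S"
  proof (rule field_le_epsilon)
    fix e :: real assume e: "0 < e"
    define W where "W = (V + C) powr (1 / q)"
    have W: "0 \<le> W" by (simp add: W_def)
    have "Lq_norm q (Q_cyl 1) M \<le> W * (S + e / (W + 1))"
      unfolding W_def using e W by (intro le) (auto simp: W_def[symmetric] add_nonneg_pos)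
    also have "\<dots> \<le> W * S + e"
      using e W by (simp add: field_simps)
    finally show "Lq_norm q (Q_cyl 1) M \<le> (V + C) powr (1 / q) * S + e" by (simp add: W_def)
  qed
  then show ?thesis by (simp add: V_def C_def)
qed

end

section \<open>From the reaction-diffusion system to the weighted equation\<close>

lemma closure_Q_cyl: "closure (Q_cyl 2 :: (real \<times> 'a::euclidean_space) set) = {-4..0} \<times> cball 0 2"
  and interior_Q_cyl: "interior (Q_cyl 2 :: (real \<times> 'a) set) = {-4<..<0} \<times> ball 0 2"
  by (simp_all add: Q_cyl_def closure_Times interior_Times)

lemma has_derivative_slice:
  fixes h :: "real \<times> 'a::euclidean_space \<Rightarrow> real"
  assumes "h differentiable (at (t, x))"
  shows "((\<lambda>y. h (t, y)) has_derivative (\<lambda>v. frechet_derivative h (at (t, x)) (0, v))) (at x)"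
proof -
  have "((\<lambda>y. (t, y)) has_derivative (\<lambda>v. (0, v))) (at x)"
    by (auto intro!: derivative_eq_intros)
  moreover have "(h has_derivative frechet_derivative h (at (t, x))) (at (t, x))"
    using assms by (simp add: frechet_derivative_works)
  ultimately show ?thesis
    using diff_chain_at[of "\<lambda>y. (t, y)" "\<lambda>v. (0, v)" x h] by (simp add: o_def)
qed

lemma DERIV_along:
  fixes f :: "'a::real_normed_vector \<Rightarrow> real"
  assumes "(f has_derivative f') (at x)"
  shows "((\<lambda>s. f (x + s *\<^sub>R v)) has_real_derivative f' v) (at 0)"
proof -
  have "((\<lambda>s. x + s *\<^sub>R v) has_derivative (\<lambda>s. s *\<^sub>R v)) (at 0)"
    by (auto intro!: derivative_eq_intros)
  moreover have "(f has_derivative f') (at (x + 0 *\<^sub>R v))" using assms by simp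
  ultimately have "((\<lambda>s. f (x + s *\<^sub>R v)) has_derivative (\<lambda>s. f' (s *\<^sub>R v))) (at 0)"
    using diff_chain_at[of "\<lambda>s. x + s *\<^sub>R v" "\<lambda>s. s *\<^sub>R v" 0 f f'] by (simp add: o_def)
  moreover have "f' (s *\<^sub>R v) = f' v * s" for s
    using linear_scale[OF has_derivative_linear[OF assms], of s v] by (simp add: mult.commute)
  ultimately show ?thesis
    by (simp add: has_field_derivative_def)
qed

lemma DERIV_time_slice:
  fixes h :: "real \<times> 'a::euclidean_space \<Rightarrow> real"
  assumes "h differentiable (at (t, x))"
  shows "((\<lambda>s. h (s, x)) has_real_derivative frechet_derivative h (at (t, x)) (1, 0)) (at t)"
proof -
  have "(h has_derivative frechet_derivative h (at (t, x))) (at (t, x))"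
    using assms by (simp add: frechet_derivative_works)
  from DERIV_along[OF this, of "(1, 0)"]
  have "((\<lambda>s. h (s + t, x)) has_real_derivative frechet_derivative h (at (t, x)) (1, 0)) (at 0)"
    by (simp add: add.commute)
  then show ?thesis
    using DERIV_shift[of "\<lambda>s. h (s, x)" "frechet_derivative h (at (t, x)) (1, 0)" 0 t] by simp
qed

text \<open>
  For the first and then the second derivatives of \<open>d M\<close> in space: on an open set the product equals a
  smooth sum, and it inherits the derivatives of that sum.
\<close>

lemma frechet_derivative_sum_slice:
  fixes h :: "'i \<Rightarrow> real \<times> 'a::euclidean_space \<Rightarrow> real"
  assumes "\<And>i. i \<in> I \<Longrightarrow> h i differentiable (at (t, x))"
    and "open U" "x \<in> U" "\<And>y. y \<in> U \<Longrightarrow> f y = (\<Sum>i\<in>I. c i * h i (t, y))"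
  shows "frechet_derivative f (at x) v = (\<Sum>i\<in>I. c i * frechet_derivative (h i) (at (t, x)) (0, v))"
proof -
  have "((\<lambda>y. \<Sum>i\<in>I. c i * h i (t, y)) has_derivative
      (\<lambda>v. \<Sum>i\<in>I. c i * frechet_derivative (h i) (at (t, x)) (0, v))) (at x)"
    using assms(1) by (intro has_derivative_sum has_derivative_mult_right has_derivative_slice)
  then have "(f has_derivative (\<lambda>v. \<Sum>i\<in>I. c i * frechet_derivative (h i) (at (t, x)) (0, v))) (at x)"
    by (rule has_derivative_transform_within_open[OF _ assms(2,3)]) (simp add: assms(4))
  from frechet_derivative_at[OF this, symmetric] show ?thesis by simp
qed

text \<open>
  Where \<open>M\<close> vanishes, the sum of the \<open>c i * a i\<close> lies between multiples of \<open>M\<close> and vanishes too, so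
  \<open>d M = (\<Sum>i. c i * a i)\<close> on the whole open cylinder. The witness \<open>L\<close> is the sum of the
  continuous extensions of the time derivatives of the \<open>a i\<close>.
\<close>

lemma nonneg_solution_weighted_diffusion:
  fixes a :: "nat \<Rightarrow> real \<times> 'a::euclidean_space \<Rightarrow> real"
  assumes lo: "0 < \<delta>lo" and c: "\<And>i. i \<in> {1..p} \<Longrightarrow> \<delta>lo \<le> c i \<and> c i \<le> \<delta>hi"
    and sol: "nonneg_solution (Q_cyl 2) \<delta>lo \<delta>hi p c a d M"
  shows "\<exists>L. weighted_diffusion M (\<lambda>z. \<Sum>i=1..p. c i * a i z) L \<delta>lo \<delta>hi
    (SUP t\<in>{-4..0}. LINT x:cball 0 2|lborel. M (t, x))"
proof -
  let ?C = "{-4..0::real} \<times> cball (0::'a) 2" and ?O = "{-4<..<0::real} \<times> ball (0::'a) 2"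
  let ?S = "SUP t\<in>{-4..0}. LINT x:cball 0 2|lborel. M (t, x)"
  define u where "u z = (\<Sum>i=1..p. c i * a i z)" for z
  note sol' = sol[unfolded nonneg_solution_def closure_Q_cyl interior_Q_cyl]
  have smooth: "smooth_up_to_boundary (Q_cyl 2) (a i)" and a_Q: "z \<in> Q_cyl 2 \<Longrightarrow> 0 \<le> a i z" if "i \<in> {1..p}" for i z
    using sol' that by auto
  have Meq: "M z = (\<Sum>i=1..p. a i z)" if "z \<in> ?C" for z using sol' that by blast
  have deq: "d z = u z / M z" if "z \<in> Q_cyl 2" "M z \<noteq> 0" for z
  proof -
    have "z \<in> ?C" using that(1) closure_subset[of "Q_cyl 2 :: (real \<times> 'a) set"] closure_Q_cyl by blast
    moreover have "d z = (\<Sum>i=1..p. c i * a i z) / (\<Sum>i=1..p. a i z)" using sol' that by blast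
    ultimately show ?thesis by (simp add: u_def Meq)
  qed
  have pde: "deriv (\<lambda>s. M (s, x)) t - laplacian (\<lambda>y. d (t, y) * M (t, y)) x = 0" if "(t, x) \<in> ?O" for t x
    using sol' that by blast
  have a_cont: "continuous_on ?C (a i)" if "i \<in> {1..p}" for i
    using smooth[OF that] by (simp add: smooth_up_to_boundary_def closure_Q_cyl)
  have diff: "iter_deriv vs (a i) differentiable (at z)" if "i \<in> {1..p}" "set vs \<subseteq> Basis" "z \<in> ?O" for i vs z
    using smooth[OF that(1)] that(2,3) unfolding smooth_up_to_boundary_def interior_Q_cyl by blast
  have OC: "z \<in> ?C" if "z \<in> ?O" for z using that by auto
  have OQ: "z \<in> Q_cyl 2" if "z \<in> ?O" for z using that by (auto simp: Q_cyl_def)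
  have a_nonneg: "0 \<le> a i z" if "i \<in> {1..p}" "z \<in> ?C" for i z
    using continuous_ge_on_closure[of "Q_cyl 2" "a i" z 0] a_cont[OF that(1)] that a_Q
    by (simp add: closure_Q_cyl)
  have e1: "(1::real, 0::'a) \<in> Basis" by (simp add: Basis_prod_def)
  have e2: "(0::real, b) \<in> Basis" if "b \<in> Basis" for b :: 'a using that by (simp add: Basis_prod_def)
  have "\<forall>i\<in>{1..p}. \<exists>g. continuous_on ?C g \<and> (\<forall>z\<in>?O. g z = iter_deriv [(1, 0)] (a i) z)"
    using smooth e1 by (auto simp: smooth_up_to_boundary_def closure_Q_cyl interior_Q_cyl simp del: iter_deriv.simps)
  from bchoice[OF this] obtain g where g: "\<And>i. i \<in> {1..p} \<Longrightarrow> continuous_on ?C (g i)"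
    "\<And>i z. i \<in> {1..p} \<Longrightarrow> z \<in> ?O \<Longrightarrow> g i z = iter_deriv [(1, 0)] (a i) z"
    by blast
  define L where "L z = (\<Sum>i=1..p. g i z)" for z
  have M_cont: "continuous_on ?C M"
    by (subst continuous_on_cong[OF refl Meq]) (assumption, intro continuous_on_sum a_cont)
  have M_deriv: "((\<lambda>s. M (s, x)) has_real_derivative L (t, x)) (at t)" if tx: "(t, x) \<in> ?O" for t x
  proof -
    have "((\<lambda>s. \<Sum>i=1..p. a i (s, x)) has_real_derivative (\<Sum>i=1..p. frechet_derivative (a i) (at (t, x)) (1, 0))) (at t)"
      using diff[of _ "[]" "(t, x)"] tx by (intro DERIV_sum DERIV_time_slice) auto
    moreover have "(\<Sum>i=1..p. frechet_derivative (a i) (at (t, x)) (1, 0)) = L (t, x)"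
      unfolding L_def using g(2) tx by (intro sum.cong) auto
    ultimately have "((\<lambda>s. \<Sum>i=1..p. a i (s, x)) has_real_derivative L (t, x)) (at t)" by simp
    moreover have ev: "\<forall>\<^sub>F s in nhds t. M (s, x) = (\<Sum>i=1..p. a i (s, x))"
      unfolding eventually_nhds using tx by (intro exI[of _ "{-4<..<0}"] conjI ballI Meq) auto
    ultimately show ?thesis using DERIV_cong_ev[OF refl ev refl] by simp
  qed
  have u_lower: "\<delta>lo * M z \<le> u z" and u_upper: "u z \<le> \<delta>hi * M z" if "z \<in> ?C" for z
    unfolding u_def Meq[OF that] sum_distrib_left using c a_nonneg[OF _ that]
    by (intro sum_mono mult_right_mono; simp)+
  have dM: "d z * M z = u z" if "z \<in> ?O" for z
  proof (cases "M z = 0")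
    case True
    then show ?thesis using u_lower[OF OC[OF that]] u_upper[OF OC[OF that]] by simp
  next
    case False
    then show ?thesis using deq OQ that by simp
  qed
  define u1 where "u1 t b x = (\<Sum>i=1..p. c i * iter_deriv [(0, b)] (a i) (t, x))" for t b x
  define u2 where "u2 t b x = (\<Sum>i=1..p. c i * iter_deriv [(0, b), (0, b)] (a i) (t, x))" for t b x
  have cont_iter: "continuous_on (ball 0 2) (\<lambda>x. \<Sum>i=1..p. c i * iter_deriv vs (a i) (t, x))"
    if t: "-4 < t" "t < 0" and vs: "set vs \<subseteq> Basis" for t vs
  proof (intro continuous_intros)
    fix i assume i: "i \<in> {1..p}"
    have "continuous_on ?O (iter_deriv vs (a i))"
      using diff[OF i vs] by (intro continuous_at_imp_continuous_on ballI differentiable_imp_continuous_within) auto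
    then show "continuous_on (ball 0 2) (\<lambda>x. iter_deriv vs (a i) (t, x))"
      by (rule continuous_on_compose2) (use t in \<open>auto intro!: continuous_intros\<close>)
  qed
  have along: "((\<lambda>s. \<Sum>i=1..p. c i * iter_deriv vs (a i) (t, x + s *\<^sub>R b)) has_real_derivative
      (\<Sum>i=1..p. c i * iter_deriv ((0, b) # vs) (a i) (t, x))) (at 0)"
    if "-4 < t" "t < 0" "set vs \<subseteq> Basis" "x \<in> ball 0 2" for t vs x b
    unfolding iter_deriv.simps using that
    by (intro DERIV_sum DERIV_cmult DERIV_along[OF has_derivative_slice] diff) auto
  have lap: "laplacian (\<lambda>y. d (t, y) * M (t, y)) x = (\<Sum>b\<in>Basis. u2 t b x)" if tx: "(t, x) \<in> ?O" for t x
  proof -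
    have "iter_deriv [b, b] (\<lambda>y. d (t, y) * M (t, y)) x = u2 t b x" if b: "b \<in> Basis" for b
    proof -
      have 1: "frechet_derivative (\<lambda>y. d (t, y) * M (t, y)) (at y) b = (\<Sum>i=1..p. c i * iter_deriv [(0, b)] (a i) (t, y))"
        if "y \<in> ball 0 2" for y
        using frechet_derivative_sum_slice[of "{1..p}" a t y "ball 0 2" "\<lambda>y. d (t, y) * M (t, y)" c b]
          diff[of _ "[]" "(t, y)"] that tx dM by (simp add: u_def)
      show ?thesis
        using frechet_derivative_sum_slice[of "{1..p}" "\<lambda>i. iter_deriv [(0, b)] (a i)" t x "ball 0 2"
            "\<lambda>y. frechet_derivative (\<lambda>y. d (t, y) * M (t, y)) (at y) b" c b]
          diff[of _ "[(0, b)]" "(t, x)"] 1 tx e2[OF b] by (simp add: u2_def)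
    qed
    then show ?thesis by (simp add: laplacian_def)
  qed
  have "weighted_diffusion M u L \<delta>lo \<delta>hi ?S"
  proof
    show "continuous_on ?C u" unfolding u_def by (intro continuous_intros a_cont)
    show "continuous_on ?C L" unfolding L_def by (intro continuous_intros g)
    show "0 \<le> M (t, x)" if tx: "t \<in> {-4..0}" "norm x \<le> 2" for t x
    proof -
      have "(t, x) \<in> ?C" using tx by simp
      then show ?thesis by (subst Meq) (assumption, intro sum_nonneg a_nonneg)
    qed
    show "\<exists>u1 u2. (\<forall>b\<in>Basis. continuous_on (ball 0 2) (u1 b) \<and> continuous_on (ball 0 2) (u2 b) \<and>
        (\<forall>x\<in>ball 0 2. ((\<lambda>s. u (t, x + s *\<^sub>R b)) has_real_derivative u1 b x) (at 0) \<and>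
           ((\<lambda>s. u1 b (x + s *\<^sub>R b)) has_real_derivative u2 b x) (at 0))) \<and>
      (\<forall>x\<in>ball 0 2. L (t, x) = (\<Sum>b\<in>Basis. u2 b x))" if t: "-4 < t" "t < 0" for t
    proof (rule exI[of _ "u1 t"], rule exI[of _ "u2 t"], intro conjI ballI)
      fix b x :: 'a assume b: "b \<in> Basis"
      show "continuous_on (ball 0 2) (u1 t b)" "continuous_on (ball 0 2) (u2 t b)"
        unfolding u1_def u2_def using e2[OF b] by (intro cont_iter[OF t]; simp)+
      assume x: "x \<in> ball 0 2"
      show "((\<lambda>s. u (t, x + s *\<^sub>R b)) has_real_derivative u1 t b x) (at 0)"
        using along[OF t, of "[]" x b] x by (simp add: u_def u1_def)
      show "((\<lambda>s. u1 t b (x + s *\<^sub>R b)) has_real_derivative u2 t b x) (at 0)"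
        using along[OF t, of "[(0, b)]" x b] x e2[OF b] by (simp add: u1_def u2_def)
    next
      fix x :: 'a assume x: "x \<in> ball 0 2"
      then have tx: "(t, x) \<in> ?O" using t by simp
      show "L (t, x) = (\<Sum>b\<in>Basis. u2 t b x)"
        using pde[OF tx] lap[OF tx] DERIV_imp_deriv[OF M_deriv[OF tx]] by simp
    qed
    show "(LINT x:cball 0 2|lborel. M (t, x)) \<le> ?S" if t: "t \<in> {-4..0}" for t
    proof (rule cSUP_upper[OF t])
      have "bounded (M ` ?C)"
        by (intro compact_imp_bounded compact_continuous_image M_cont compact_Times) auto
      then obtain B where B: "\<And>z. z \<in> ?C \<Longrightarrow> norm (M z) \<le> B" unfolding bounded_iff by blast
      show "bdd_above ((\<lambda>t. LINT x:cball 0 2|lborel. M (t, x)) ` {-4..0})"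
      proof (rule bdd_aboveI2)
        fix t :: real assume t: "t \<in> {-4..0}"
        show "(LINT x:cball 0 2|lborel. M (t, x)) \<le> (LINT x:cball (0::'a) 2|lborel. B)"
        proof (rule set_integral_mono)
          show "set_integrable lborel (cball 0 2) (\<lambda>x. M (t, x))"
            using t by (intro set_integrable_compact continuous_on_compose2[OF M_cont] continuous_intros) auto
          show "set_integrable lborel (cball (0::'a) 2) (\<lambda>x. B)"
            by (intro set_integrable_compact) auto
          show "M (t, x) \<le> B" if "x \<in> cball 0 2" for x
            using B[of "(t, x)"] t that by auto
        qed
      qed
    qed
    show "((\<lambda>s. M (s, x)) has_real_derivative L (t, x)) (at t)" if "-4 < t" "t < 0" "norm x < 2" for t x
      using that by (intro M_deriv) simp
    show "\<delta>lo * M (t, x) \<le> u (t, x)" "u (t, x) \<le> \<delta>hi * M (t, x)" if "t \<in> {-4..0}" "norm x \<le> 2" for t x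
      using that u_lower[of "(t, x)"] u_upper[of "(t, x)"] by simp_all
  qed (fact lo M_cont)+
  then show ?thesis unfolding u_def by blast
qed

theorem proposition4p1:
  fixes p :: nat and c :: "nat \<Rightarrow> real" and \<delta>lo \<delta>hi :: real
  assumes "1 \<le> p" and "0 < \<delta>lo"
    and "\<And>i. i \<in> {1..p} \<Longrightarrow> \<delta>lo \<le> c i \<and> c i \<le> \<delta>hi"
  shows "\<exists>K>0. \<forall>(a :: nat \<Rightarrow> real \<times> (real ^ 'n) \<Rightarrow> real) d M.
           nonneg_solution (Q_cyl 2) \<delta>lo \<delta>hi p c a d M \<longrightarrow>
           Lq_norm ((real CARD('n) + 1) / real CARD('n)) (Q_cyl 1) M
             \<le> K * (SUP t\<in>{-4..0}. LINT x:cball 0 2|lborel. M (t, x))"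
proof -
  define N where "N = real CARD('n)"
  define q where "q = (N + 1) / N"
  have "1 \<le> N" by (simp add: N_def Suc_leI)
  then have q: "1 \<le> q" "q \<le> 2" by (auto simp: q_def field_simps)
  define K where "K = (measure lborel ({-1..0::real} \<times> cball (0::real ^ 'n) 1)
    + \<bar>L2_const \<delta>lo \<delta>hi DIM(real ^ 'n)\<bar>) powr (1 / q)"
  have K: "0 \<le> K" by (simp add: K_def)
  show ?thesis
  \<comment> \<open>Adding \<open>1\<close> makes the constant positive.\<close>
  proof (intro exI[of _ "K + 1"] conjI allI impI)
    show "0 < K + 1" using K by simp
    fix a d and M :: "real \<times> (real ^ 'n) \<Rightarrow> real"
    let ?S = "SUP t\<in>{-4..0}. LINT x:cball 0 2|lborel. M (t, x)"
    assume "nonneg_solution (Q_cyl 2) \<delta>lo \<delta>hi p c a d M"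
    from nonneg_solution_weighted_diffusion[OF assms(2,3) this]
    obtain L where "weighted_diffusion M (\<lambda>z. \<Sum>i=1..p. c i * a i z) L \<delta>lo \<delta>hi ?S"
      by blast
    then interpret weighted_diffusion M "\<lambda>z. \<Sum>i=1..p. c i * a i z" L \<delta>lo \<delta>hi ?S .
    have "Lq_norm q (Q_cyl 1) M \<le> K * ?S" unfolding K_def by (rule Lq_bound[OF q])
    also have "\<dots> \<le> (K + 1) * ?S" using S_nonneg by (simp add: algebra_simps)
    finally show "Lq_norm ((real CARD('n) + 1) / real CARD('n)) (Q_cyl 1) M \<le> (K + 1) * ?S"
      by (simp add: q_def N_def)
  qed
qed

end
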